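(* Let $(\Omega,\mathcal{F},\mathbb{P},\sigma)$ be an ergodic probability measure-preserving dynamical system and let $F\in\widetilde{\mathcal{E}}(\Omega)$ be an integrable random lift of the generator of a random circle endomorphism over $(\Omega,\mathcal{F},\mathbb{P},\sigma)$, with lower and upper maps $F_L,F_U$. Then there exists a $\sigma$-invariant full-measure set $\Omega^*\subset\Omega$ such that for every $\omega\in\Omega^*$ the following hold: (1) $\mathrm{Rot}_F(\omega)=\mathrm{Rot}^+_F(\omega)=\mathrm{Rot}^-_F(\omega)=\mathrm{Rot}^{\mathrm{ord}}_F(\omega)=\mathrm{Rot}^{\mathrm{sub}}_F(\omega)=[\rho(F_L),\rho(F_U)]$. In particular, the closure in the definition of $\mathrm{Rot}_F(\omega)$ is redundant for every $\omega\in\Omega^*$. (2) For every $c\in[\rho(F_L),\rho(F_U)]$ there exists a point $x_c=x_c(\omega)\in[0,1]$ such that $$\lim_{n\to\infty}\frac{F^{(n)}_\omega(x_c(\omega))-x_c(\omega)}{n}=c.$$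
   Context: $\mathbb{S}^1=\mathbb{R}/\mathbb{Z}$, $\pi:\mathbb{R}\to\mathbb{S}^1$ is the projection. $\mathrm{End}_1(\mathbb{S}^1)$ is the set of continuous degree-one circle maps; $\mathrm{End}_1(\mathbb{R})$ is the set of continuous $F:\mathbb{R}\to\mathbb{R}$ with $F(x+1)=F(x)+1$ for all $x$; $\mathrm{Mon}_1(\mathbb{R})$ is the set of non-decreasing elements of $\mathrm{End}_1(\mathbb{R})$. A random circle endomorphism over $(\Omega,\mathcal{F},\mathbb{P},\sigma)$ is given by a generator, i.e. a measurable map $f:\Omega\to\mathrm{End}_1(\mathbb{S}^1)$, $\omega\mapsto f_\omega$, through the cocycle $f^{(n)}_\omega=f_{\sigma^{n-1}\omega}\circ\cdots\circ f_\omega$. A random lift of $f$ is a measurable map $F:\Omega\to\mathrm{End}_1(\mathbb{R})$ with $\pi\circ F_\omega=f_\omega\circ\pi$ for every $\omega$; its cocycle is $F^{(n)}_\omega=F_{\sigma^{n-1}\omega}\circ\cdots\circ F_\omega$. $\widetilde{\mathcal{E}}(\Omega)$ is the set of measurable $F:\Omega\to\mathrm{End}_1(\mathbb{R})$ with $\int_\Omega\|F_\omega-\mathrm{Id}\|\,\mathrm{d}\mathbb{P}(\omega)<\infty$, where $\|\cdot\|$ is the sup norm; $\widetilde{\mathcal{M}}(\Omega)$ is the subset of those $F$ with values in $\mathrm{Mon}_1(\mathbb{R})$. Lower and upper maps: $F_{\omega,L}(x)=\inf_{y\ge x}F_\omega(y)$, $F_{\omega,U}(x)=\sup_{y\le x}F_\omega(y)$;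 both $F_L,F_U$ belong to $\widetilde{\mathcal{M}}(\Omega)$. For $G\in\widetilde{\mathcal{M}}(\Omega)$, by a known result (Li–Lu) there is an integrable function $\rho_G$, the random rotation number, such that for any $x\in\mathbb{R}$, $\lim_{n\to\infty}(G^{(n)}_\omega(x)-x)/n=\rho_G(\omega)$ for a.e. $\omega$; $\rho(G)=\int_\Omega\rho_G\,\mathrm{d}\mathbb{P}$ is its mean (for ergodic $\sigma$, $\rho_G=\rho(G)$ a.e.). Rotation sets: with $A_n(\omega,x)=(F^{(n)}_\omega(x)-x)/n$, define $\mathrm{Rot}^+_F(\omega)=\{\limsup_{n\to\infty}A_n(\omega,x):x\in\mathbb{R}\}$; $\mathrm{Rot}_F(\omega)=\overline{\mathrm{Rot}^+_F(\omega)}$ (closure in $\mathbb{R}$); $\mathrm{Rot}^-_F(\omega)=\{\liminf_{n\to\infty}A_n(\omega,x):x\in\mathbb{R}\}$; $\mathrm{Rot}^{\mathrm{ord}}_F(\omega)=\{c\in\mathbb{R}:\exists x\in\mathbb{R},\ \lim_{n\to\infty}A_n(\omega,x)=c\}$; $\mathrm{Rot}^{\mathrm{sub}}_F(\omega)=\{c\in\mathbb{R}:\exists n_k\to\infty,\ \exists y_k\in\mathbb{R},\ \lim_{k\to\infty}A_{n_k}(\omega,y_k)=c\}$. *)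

theory Defs
  imports "HOL-Probability.Probability"
begin

section \<open>The circle\<close>

quotient_type circle = real / "\<lambda>x y. x - y \<in> \<int>"
  morphisms rep_circle circle_of
proof (rule equivpI)
  show "reflp (\<lambda>x y::real. x - y \<in> \<int>)" by (simp add: reflp_def)
  have "y - x \<in> \<int>" if "x - y \<in> \<int>" for x y :: real
    using Ints_minus[OF that] by simp
  then show "symp (\<lambda>x y::real. x - y \<in> \<int>)" by (auto intro: sympI)
  have "x - z \<in> \<int>" if "x - y \<in> \<int>" "y - z \<in> \<int>" for x y z :: real
    using Ints_add[OF that] by simp
  then show "transp (\<lambda>x y::real. x - y \<in> \<int>)" by (auto intro: transpI)
qed

lemma circle_of_eq_iff: "circle_of x = circle_of y \<longleftrightarrow> x - y \<in> \<int>"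
  by (rule circle.abs_eq_iff)

lemma surj_circle_of: "\<exists>x. p = circle_of x"
  using Quotient_abs_rep[OF Quotient_circle, of p] by (intro exI) (rule sym)

text \<open>The flat metric. It induces the quotient topology of the reals modulo the integers,
  see \<open>open_circle_iff\<close> below.\<close>

instantiation circle :: metric_space
begin

definition dist_circle :: "circle \<Rightarrow> circle \<Rightarrow> real" where
  "dist_circle p q = Inf {dist x y |x y. circle_of x = p \<and> circle_of y = q}"

definition uniformity_circle :: "(circle \<times> circle) filter" where
  "uniformity_circle = (INF e\<in>{0 <..}. principal {(x, y). dist x y < e})"

definition open_circle :: "circle set \<Rightarrow> bool" where
  "open_circle U \<longleftrightarrow> (\<forall>x\<in>U. eventually (\<lambda>(x', y). x' = x \<longrightarrow> y \<in> U) uniformity)"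

lemma dist_circle_le: "dist (circle_of x) (circle_of y) \<le> dist x y"
  unfolding dist_circle_def
  by (rule cInf_lower) (auto intro!: bdd_belowI[where m=0])

lemma dist_circle_attained:
  obtains x where "circle_of x = p" "dist p (circle_of y) = dist x y"
proof -
  obtain x0 where x0: "p = circle_of x0" using surj_circle_of by blast
  define x where "x = x0 - of_int (round (x0 - y))"
  have px: "circle_of x = p" unfolding x0 circle_of_eq_iff x_def by simp
  have le: "dist x y \<le> dist u v" if "circle_of u = p" "circle_of v = circle_of y" for u v
  proof -
    have "u - x0 \<in> \<int>" "v - y \<in> \<int>"
      using that unfolding x0 circle_of_eq_iff by simp_all
    then obtain m n :: int where mn: "u - x0 = of_int m" "v - y = of_int n"
      by (elim Ints_cases)
    have eq: "u - v = (x0 - y) - of_int (n - m)" using mn by simp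
    have "\<bar>(x0 - y) - of_int (round (x0 - y))\<bar> \<le> \<bar>(x0 - y) - of_int (n - m)\<bar>"
      by (rule round_diff_minimal)
    then show ?thesis by (simp add: dist_real_def x_def eq algebra_simps)
  qed
  have "dist x y \<le> dist p (circle_of y)"
    unfolding dist_circle_def using px le by (intro cInf_greatest) auto
  moreover have "dist p (circle_of y) \<le> dist x y"
    using dist_circle_le[of x y] px by simp
  ultimately show thesis using that[OF px] by simp
qed

instance
proof
  show "uniformity = (INF e\<in>{0 <..}. principal {(x, y::circle). dist x y < e})"
    by (rule uniformity_circle_def)
  show "open U \<longleftrightarrow> (\<forall>x\<in>U. \<forall>\<^sub>F (x', y) in uniformity. x' = x \<longrightarrow> y \<in> U)" for U :: "circle set"
    by (rule open_circle_def)
  show "dist p q = 0 \<longleftrightarrow> p = q" for p q :: circle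
  proof
    assume d: "dist p q = 0"
    obtain y where y: "q = circle_of y" using surj_circle_of by blast
    obtain x where "circle_of x = p" "dist p q = dist x y"
      using dist_circle_attained[of p y] y by metis
    with d y show "p = q" by simp
  next
    assume "p = q"
    obtain y where y: "q = circle_of y" using surj_circle_of by blast
    obtain x where x: "circle_of x = p" "dist p (circle_of y) = dist x y"
      by (rule dist_circle_attained)
    have "dist (circle_of y) (circle_of y) \<le> 0" using dist_circle_le[of y y] by simp
    then show "dist p q = 0" using x \<open>p = q\<close> y by simp
  qed
  show "dist p q \<le> dist p r + dist q r" for p q r :: circle
  proof -
    obtain z where z: "r = circle_of z" using surj_circle_of by blast
    obtain x where x: "circle_of x = p" "dist p r = dist x z"
      using dist_circle_attained[of p z] z by metis
    obtain y where y: "circle_of y = q" "dist q r = dist y z"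
      using dist_circle_attained[of q z] z by metis
    have "dist p q \<le> dist x y" using dist_circle_le[of x y] x y by simp
    also have "\<dots> \<le> dist x z + dist y z" by (rule dist_triangle2)
    finally show ?thesis using x y by simp
  qed
qed

end

lemma continuous_circle_of: "continuous_on S circle_of"
  unfolding continuous_on_iff
proof (intro ballI allI impI)
  fix x and e :: real assume "e > 0"
  then show "\<exists>d>0. \<forall>x'\<in>S. dist x' x < d \<longrightarrow> dist (circle_of x') (circle_of x) < e"
    using order.strict_trans1[OF dist_circle_le] by blast
qed

lemma open_circle_iff: "open U \<longleftrightarrow> open (circle_of -` U)"
proof
  assume "open U"
  then show "open (circle_of -` U)"
    using continuous_circle_of[of UNIV] by (simp add: continuous_on_open_vimage)
next
  assume *: "open (circle_of -` U)"
  show "open U"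
    unfolding open_dist
  proof (intro ballI)
    fix p assume p: "p \<in> U"
    obtain y where y: "p = circle_of y" using surj_circle_of by blast
    then obtain e where e: "e > 0" "\<And>x. dist x y < e \<Longrightarrow> circle_of x \<in> U"
      using * p unfolding open_dist by auto
    have "q \<in> U" if "dist q p < e" for q
    proof -
      obtain x where "circle_of x = q" "dist q p = dist x y"
        using dist_circle_attained[of q y] y by metis
      then show ?thesis using e that by auto
    qed
    then show "\<exists>e>0. \<forall>q. dist q p < e \<longrightarrow> q \<in> U" using e by blast
  qed
qed

lemma bounded_circle: "bounded (S :: circle set)"
proof -
  have "dist p q \<le> 1" for p q :: circle
  proof -
    obtain x where x: "p = circle_of x" using surj_circle_of by blast
    obtain y where y: "q = circle_of y" using surj_circle_of by blast
    have "p = circle_of (frac x)" "q = circle_of (frac y)"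
      unfolding x y circle_of_eq_iff by (simp_all add: frac_def)
    then have "dist p q \<le> dist (frac x) (frac y)" using dist_circle_le by simp
    also have "\<dots> \<le> 1"
      using frac_lt_1[of x] frac_lt_1[of y] frac_ge_0[of x] frac_ge_0[of y]
      unfolding dist_real_def by linarith
    finally show ?thesis .
  qed
  then show ?thesis unfolding bounded_def by (intro exI ballI)
qed


section \<open>Degree-one maps and their uniform topologies\<close>

definition End1_real :: "(real \<Rightarrow> real) set" where
  "End1_real = {G. continuous_on UNIV G \<and> (\<forall>x. G (x + 1) = G x + 1)}"

definition End1_circle :: "(circle \<Rightarrow> circle) set" where
  "End1_circle = {g. continuous_on UNIV g \<and> (\<exists>G\<in>End1_real. circle_of \<circ> G = g \<circ> circle_of)}"

text \<open>The map \<open>G - Id\<close> as an element of the space of bounded continuous functions, whose norm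
  is the sup norm. The constructor \<open>Bcontfun\<close> is meaningful for \<open>G \<in> End1_real\<close> only, see
  \<open>displacement_bcontfun\<close>.\<close>

definition displacement :: "(real \<Rightarrow> real) \<Rightarrow> (real \<Rightarrow>\<^sub>C real)" where
  "displacement G = Bcontfun (\<lambda>x. G x - x)"

lemma displacement_bcontfun:
  assumes "G \<in> End1_real"
  shows "(\<lambda>x. G x - x) \<in> bcontfun"
proof -
  let ?d = "\<lambda>x. G x - x"
  have cont: "continuous_on UNIV ?d" and step: "\<And>x. ?d (x + 1) = ?d x"
    using assms by (auto simp: End1_real_def intro!: continuous_intros)
  have nat: "?d (x + of_nat n) = ?d x" for x n
  proof (induction n)
    case (Suc n)
    have "?d (x + of_nat (Suc n)) = ?d ((x + of_nat n) + 1)" by (simp add: algebra_simps)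
    then show ?case using step Suc by simp
  qed simp
  have int: "?d (x + of_int k) = ?d x" for x k
    using nat[of x "nat k"] nat[of "x + of_int k" "nat (- k)"] by (cases "k \<ge> 0") simp_all
  have "range ?d \<subseteq> ?d ` {0..1}"
  proof clarify
    fix x
    have "?d x = ?d (frac x)" using int[of "frac x" "floor x"] by (simp add: frac_def)
    moreover have "frac x \<in> {0..1}" using frac_ge_0[of x] frac_lt_1[of x] by simp
    ultimately show "?d x \<in> ?d ` {0..1}" by blast
  qed
  moreover have "compact (?d ` {0..1})"
    by (rule compact_continuous_image[OF continuous_on_subset[OF cont]]) auto
  ultimately have "bounded (range ?d)" using compact_imp_bounded bounded_subset by blast
  with cont show ?thesis by (simp add: bcontfun_def)
qed

lemma End1_circle_bcontfun: "g \<in> End1_circle \<Longrightarrow> g \<in> bcontfun"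
  by (simp add: End1_circle_def bcontfun_def bounded_circle)

text \<open>Borel sigma-algebras of the uniform metrics; note that the sup distance of \<open>G\<close> and \<open>H\<close>
  equals that of \<open>G - Id\<close> and \<open>H - Id\<close>.\<close>

definition borel_End1_real :: "(real \<Rightarrow> real) measure" where
  "borel_End1_real = vimage_algebra End1_real displacement borel"

definition borel_End1_circle :: "(circle \<Rightarrow> circle) measure" where
  "borel_End1_circle = vimage_algebra End1_circle Bcontfun borel"


section \<open>Random circle endomorphisms and their lifts\<close>

text \<open>Invertibility of \<open>\<sigma>\<close> is not assumed.\<close>

locale ergodic_pmps = prob_space M for M :: "'w measure" +
  fixes \<sigma> :: "'w \<Rightarrow> 'w"
  assumes measurable_sigma: "\<sigma> \<in> M \<rightarrow>\<^sub>M M"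
    and preserving: "distr M M \<sigma> = M"
    and ergodic: "\<And>A. A \<in> sets M \<Longrightarrow> \<sigma> -` A \<inter> space M = A \<Longrightarrow> prob A = 0 \<or> prob A = 1"

definition random_endo_generator :: "'w measure \<Rightarrow> ('w \<Rightarrow> circle \<Rightarrow> circle) \<Rightarrow> bool" where
  "random_endo_generator M f \<longleftrightarrow> f \<in> M \<rightarrow>\<^sub>M borel_End1_circle"

definition random_lift :: "'w measure \<Rightarrow> ('w \<Rightarrow> circle \<Rightarrow> circle) \<Rightarrow> ('w \<Rightarrow> real \<Rightarrow> real) \<Rightarrow> bool" where
  "random_lift M f F \<longleftrightarrow> F \<in> M \<rightarrow>\<^sub>M borel_End1_real \<and>
     (\<forall>\<omega>\<in>space M. circle_of \<circ> F \<omega> = f \<omega> \<circ> circle_of)"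

definition integrable_End1 :: "'w measure \<Rightarrow> ('w \<Rightarrow> real \<Rightarrow> real) set" where
  "integrable_End1 M = {F \<in> M \<rightarrow>\<^sub>M borel_End1_real. integrable M (\<lambda>\<omega>. norm (displacement (F \<omega>)))}"

primrec cocycle :: "('w \<Rightarrow> 'w) \<Rightarrow> ('w \<Rightarrow> 'a \<Rightarrow> 'a) \<Rightarrow> nat \<Rightarrow> 'w \<Rightarrow> 'a \<Rightarrow> 'a" where
  "cocycle \<sigma> F 0 \<omega> = id"
| "cocycle \<sigma> F (Suc n) \<omega> = F ((\<sigma> ^^ n) \<omega>) \<circ> cocycle \<sigma> F n \<omega>"

definition lower_map :: "('w \<Rightarrow> real \<Rightarrow> real) \<Rightarrow> 'w \<Rightarrow> real \<Rightarrow> real" where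
  "lower_map F \<omega> x = (INF y\<in>{x..}. F \<omega> y)"

definition upper_map :: "('w \<Rightarrow> real \<Rightarrow> real) \<Rightarrow> 'w \<Rightarrow> real \<Rightarrow> real" where
  "upper_map F \<omega> x = (SUP y\<in>{..x}. F \<omega> y)"

definition avg_displacement ::
    "('w \<Rightarrow> 'w) \<Rightarrow> ('w \<Rightarrow> real \<Rightarrow> real) \<Rightarrow> nat \<Rightarrow> 'w \<Rightarrow> real \<Rightarrow> real" where
  "avg_displacement \<sigma> F n \<omega> x = (cocycle \<sigma> F n \<omega> x - x) / real n"


section \<open>Rotation numbers and rotation sets\<close>

definition is_random_rotation_number ::
    "'w measure \<Rightarrow> ('w \<Rightarrow> 'w) \<Rightarrow> ('w \<Rightarrow> real \<Rightarrow> real) \<Rightarrow> ('w \<Rightarrow> real) \<Rightarrow> bool" where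
  "is_random_rotation_number M \<sigma> G r \<longleftrightarrow> integrable M r \<and>
     (\<forall>x. AE \<omega> in M. (\<lambda>n. avg_displacement \<sigma> G n \<omega> x) \<longlonglongrightarrow> r \<omega>)"

text \<open>For integrable non-decreasing \<open>G\<close> the random rotation number exists by a theorem of Li and
  Lu. It is unique up to null sets, so its mean does not depend on the choice made here.\<close>

definition random_rotation_number ::
    "'w measure \<Rightarrow> ('w \<Rightarrow> 'w) \<Rightarrow> ('w \<Rightarrow> real \<Rightarrow> real) \<Rightarrow> 'w \<Rightarrow> real" where
  "random_rotation_number M \<sigma> G = (SOME r. is_random_rotation_number M \<sigma> G r)"

definition mean_rotation_number ::
    "'w measure \<Rightarrow> ('w \<Rightarrow> 'w) \<Rightarrow> ('w \<Rightarrow> real \<Rightarrow> real) \<Rightarrow> real" where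
  "mean_rotation_number M \<sigma> G = (\<integral>\<omega>. random_rotation_number M \<sigma> G \<omega> \<partial>M)"

text \<open>Upper and lower limits are taken in the extended reals, so these two sets may contain
  infinite values for exceptional \<open>\<omega>\<close>.\<close>

definition Rot_plus :: "('w \<Rightarrow> 'w) \<Rightarrow> ('w \<Rightarrow> real \<Rightarrow> real) \<Rightarrow> 'w \<Rightarrow> ereal set" where
  "Rot_plus \<sigma> F \<omega> = {limsup (\<lambda>n. ereal (avg_displacement \<sigma> F n \<omega> x)) |x. True}"

definition Rot_minus :: "('w \<Rightarrow> 'w) \<Rightarrow> ('w \<Rightarrow> real \<Rightarrow> real) \<Rightarrow> 'w \<Rightarrow> ereal set" where
  "Rot_minus \<sigma> F \<omega> = {liminf (\<lambda>n. ereal (avg_displacement \<sigma> F n \<omega> x)) |x. True}"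

text \<open>The closure is taken in the real line.\<close>

definition Rot :: "('w \<Rightarrow> 'w) \<Rightarrow> ('w \<Rightarrow> real \<Rightarrow> real) \<Rightarrow> 'w \<Rightarrow> real set" where
  "Rot \<sigma> F \<omega> = closure {c. ereal c \<in> Rot_plus \<sigma> F \<omega>}"

definition Rot_ord :: "('w \<Rightarrow> 'w) \<Rightarrow> ('w \<Rightarrow> real \<Rightarrow> real) \<Rightarrow> 'w \<Rightarrow> real set" where
  "Rot_ord \<sigma> F \<omega> = {c. \<exists>x. (\<lambda>n. avg_displacement \<sigma> F n \<omega> x) \<longlonglongrightarrow> c}"

definition Rot_sub :: "('w \<Rightarrow> 'w) \<Rightarrow> ('w \<Rightarrow> real \<Rightarrow> real) \<Rightarrow> 'w \<Rightarrow> real set" where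
  "Rot_sub \<sigma> F \<omega> = {c. \<exists>(n :: nat \<Rightarrow> nat) (y :: nat \<Rightarrow> real).
     filterlim n at_top sequentially \<and> (\<lambda>k. avg_displacement \<sigma> F (n k) \<omega> (y k)) \<longlonglongrightarrow> c}"

end

theory Submission
  imports Defs
begin

text \<open>For a monotone random lift \<open>G\<close> the quantities \<open>a n \<omega> = cocycle \<sigma> G n \<omega> 0\<close> are additive along the base
  up to an error \<open>1\<close>, so Birkhoff's theorem applied to each \<open>a k\<close> yields the rotation number, and
  shows that it is within \<open>1 / k\<close> of the mean of \<open>a k / k\<close>. For a general lift \<open>F\<close>, truncate \<open>F\<close> at
  the lower map raised by \<open>t\<close> times a random bound on the gap between lower and upper map, and
  take the upper map of the truncation. These monotone maps \<open>W t\<close> run from the lower to the upper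
  map; their rotation number is continuous in \<open>t\<close> and thus takes every value in between. Every value
  of \<open>W t \<omega>\<close> is attained at a point where \<open>W t \<omega>\<close> and \<open>F \<omega>\<close> agree, so by compactness some point of
  the unit interval has the same orbit under both cocycles.\<close>

section \<open>The ergodic theorem\<close>

text \<open>The displacement of a monotone degree-one map oscillates by at most 1. Compositions keep
  this bound, so the defect of additivity does not grow with time; hence Birkhoff's theorem at each
  fixed block length suffices, and no subadditive theorem is called for. A non-monotone
  \<open>F\<close> has no such control. A monotone family between the two envelopes helps only if it
  follows true orbits of \<open>F\<close>. Linear interpolation between the envelopes would be
  continuous too, but it may rise strictly where it differs from \<open>F\<close> and so skip
  values. Truncating before taking the upper map confines the disagreement with \<open>F\<close> to
  plateaus of the resulting map, whose right ends are points of agreement. Since every value is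
  attained in this way, orbits can be chosen backwards. The displacement of \<open>F\<close> is
  bounded only by an integrable function of \<omega>. The height of the truncation is therefore a
  multiple of that function: one parameter then reaches the upper map for all \<omega> at once, and
  one integrable function dominates the whole family.\<close>

context ergodic_pmps
begin

lemma measurable_sigma_funpow: "(\<sigma> ^^ n) \<in> M \<rightarrow>\<^sub>M M"
  using measurable_sigma by (induction n) (auto simp: comp_def)

lemma sigma_space: "\<omega> \<in> space M \<Longrightarrow> (\<sigma> ^^ n) \<omega> \<in> space M"
  using measurable_sigma_funpow[of n] by (auto simp: measurable_def)

lemma
  fixes g :: "'w \<Rightarrow> real"
  assumes "integrable M g"
  shows integrable_sigma: "integrable M (\<lambda>\<omega>. g (\<sigma> \<omega>))"
    and integral_sigma: "(\<integral>\<omega>. g (\<sigma> \<omega>) \<partial>M) = (\<integral>\<omega>. g \<omega> \<partial>M)"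
proof -
  show "integrable M (\<lambda>\<omega>. g (\<sigma> \<omega>))"
    using assms by (intro integrable_distr[OF measurable_sigma]) (simp add: preserving)
  have "(\<integral>\<omega>. g \<omega> \<partial>M) = (\<integral>\<omega>. g \<omega> \<partial>distr M M \<sigma>)" by (simp add: preserving)
  also have "\<dots> = (\<integral>\<omega>. g (\<sigma> \<omega>) \<partial>M)"
    using assms by (intro integral_distr[OF measurable_sigma]) auto
  finally show "(\<integral>\<omega>. g (\<sigma> \<omega>) \<partial>M) = (\<integral>\<omega>. g \<omega> \<partial>M)" ..
qed

lemma integrable_sigma_funpow:
  fixes g :: "'w \<Rightarrow> real"
  assumes "integrable M g"
  shows "integrable M (\<lambda>\<omega>. g ((\<sigma> ^^ n) \<omega>))"
proof (induction n)
  case (Suc n)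
  then show ?case using integrable_sigma[OF Suc] by (simp add: funpow_swap1)
qed (use assms in simp)

text \<open>This is the maximum of the Birkhoff sums of length 0 to \<open>n\<close>. The recursive
  form makes \<open>max_birkhoff g (Suc n) \<omega> - max_birkhoff g n (\<sigma> \<omega>)\<close> a
  maximum of two explicit terms.\<close>

primrec max_birkhoff :: "('w \<Rightarrow> real) \<Rightarrow> nat \<Rightarrow> 'w \<Rightarrow> real" where
  "max_birkhoff g 0 \<omega> = 0"
| "max_birkhoff g (Suc n) \<omega> = max 0 (g \<omega> + max_birkhoff g n (\<sigma> \<omega>))"

lemma max_birkhoff_nonneg: "0 \<le> max_birkhoff g n \<omega>"
  by (cases n) auto

lemma max_birkhoff_le_Suc: "max_birkhoff g n \<omega> \<le> max_birkhoff g (Suc n) \<omega>"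
proof (induction n arbitrary: \<omega>)
  case (Suc n)
  show ?case using Suc[of "\<sigma> \<omega>"] by simp
qed simp

lemma max_birkhoff_mono: "m \<le> n \<Longrightarrow> max_birkhoff g m \<omega> \<le> max_birkhoff g n \<omega>"
  by (rule lift_Suc_mono_le[where f="\<lambda>n. max_birkhoff g n \<omega>", OF max_birkhoff_le_Suc])

lemma birkhoff_sum_le_max_birkhoff: "(\<Sum>j<n. g ((\<sigma> ^^ j) \<omega>)) \<le> max_birkhoff g n \<omega>"
proof (induction n arbitrary: \<omega>)
  case (Suc n)
  have "(\<Sum>j<Suc n. g ((\<sigma> ^^ j) \<omega>)) = g \<omega> + (\<Sum>j<n. g ((\<sigma> ^^ j) (\<sigma> \<omega>)))"
    by (simp add: sum.lessThan_Suc_shift funpow_swap1 del: sum.lessThan_Suc)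
  then show ?case using Suc[of "\<sigma> \<omega>"] by simp
qed simp

lemma integrable_max_birkhoff:
  assumes "integrable M g"
  shows "integrable M (max_birkhoff g n)"
proof (induction n)
  case 0
  have "max_birkhoff g 0 = (\<lambda>_. 0)" by auto
  then show ?case by simp
next
  case (Suc n)
  have "max_birkhoff g (Suc n) = (\<lambda>\<omega>. max 0 (g \<omega> + max_birkhoff g n (\<sigma> \<omega>)))" by auto
  then show ?case using assms integrable_sigma[OF Suc] by simp
qed

text \<open>If the running maxima were unbounded on a set of full measure, then
  \<open>max_birkhoff g (n + 1) - max_birkhoff g n \<circ> \<sigma>\<close>, whose integral is nonnegative, would
  converge to \<open>g\<close>.\<close>

lemma AE_birkhoff_sum_bounded_above:
  fixes g :: "'w \<Rightarrow> real"
  assumes g: "integrable M g" and neg: "(\<integral>\<omega>. g \<omega> \<partial>M) < 0"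
  shows "AE \<omega> in M. \<exists>B. \<forall>n. (\<Sum>j<n. g ((\<sigma> ^^ j) \<omega>)) \<le> B"
proof -
  let ?m = "max_birkhoff g"
  define E where "E = {\<omega>\<in>space M. \<forall>k::nat. \<exists>n. real k < ?m n \<omega>}"
  have meas: "?m n \<in> borel_measurable M" for n
    using integrable_max_birkhoff[OF g] by auto
  have E: "E \<in> sets M" unfolding E_def using meas by measurable
  \<comment> \<open>Passing from \<omega> to \<open>\<sigma> \<omega>\<close> changes the running
    maxima by the finite number \<open>g \<omega>\<close>, up to the cut at 0 and an index shift. So
    unboundedness is invariant, and ergodicity decides the measure of \<open>E\<close>.\<close>
  have shift: "(\<forall>k::nat. \<exists>n. real k < ?m n (\<sigma> \<omega>)) \<longleftrightarrow> (\<forall>k::nat. \<exists>n. real k < ?m n \<omega>)" for \<omega>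
  proof (intro iffI allI)
    fix k assume *: "\<forall>k::nat. \<exists>n. real k < ?m n (\<sigma> \<omega>)"
    obtain l :: nat where "real k - g \<omega> < l" using reals_Archimedean2 by blast
    moreover obtain n where "real l < ?m n (\<sigma> \<omega>)" using * by blast
    ultimately have "real k < ?m (Suc n) \<omega>" by simp
    then show "\<exists>n. real k < ?m n \<omega>" by blast
  next
    fix k assume *: "\<forall>k::nat. \<exists>n. real k < ?m n \<omega>"
    obtain l :: nat where l: "real k + \<bar>g \<omega>\<bar> < l" using reals_Archimedean2 by blast
    obtain n where n: "real l < ?m n \<omega>" using * by blast
    then have "real l < ?m (Suc n) \<omega>" using max_birkhoff_le_Suc[of g n \<omega>] by linarith
    then have "real k < ?m n (\<sigma> \<omega>)" using l by auto
    then show "\<exists>n. real k < ?m n (\<sigma> \<omega>)" by blast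
  qed
  have "\<sigma> -` E \<inter> space M = E"
    using shift sigma_space[of _ 1] by (auto simp: E_def)
  then have "prob E = 0 \<or> prob E = 1" using ergodic E by blast
  moreover have "prob E \<noteq> 1"
  proof
    assume "prob E = 1"
    then have AE_E: "AE \<omega> in M. \<omega> \<in> E" using AE_prob_1 by blast
    let ?d = "\<lambda>n \<omega>. ?m (Suc n) \<omega> - ?m n (\<sigma> \<omega>)"
    \<comment> \<open>The first argument is at most 0, so the maximum equals
      \<open>g \<omega>\<close> or lies between \<open>g \<omega>\<close> and 0. Either way
      \<open>\<bar>g \<omega>\<bar>\<close> dominates.\<close>
    have d: "?d n \<omega> = max (- ?m n (\<sigma> \<omega>)) (g \<omega>)" for n \<omega> by auto
    have "(\<lambda>n. \<integral>\<omega>. ?d n \<omega> \<partial>M) \<longlonglongrightarrow> (\<integral>\<omega>. g \<omega> \<partial>M)"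
    proof (rule integral_dominated_convergence[where w="\<lambda>\<omega>. \<bar>g \<omega>\<bar>"])
      show "g \<in> borel_measurable M" using g by auto
      show "(\<lambda>\<omega>. ?d n \<omega>) \<in> borel_measurable M" for n
        using meas measurable_compose[OF measurable_sigma meas] by (intro borel_measurable_diff)
      show "integrable M (\<lambda>\<omega>. \<bar>g \<omega>\<bar>)" using g by simp
      show "AE \<omega> in M. norm (?d n \<omega>) \<le> \<bar>g \<omega>\<bar>" for n
      proof (rule AE_I2)
        fix \<omega>
        show "norm (?d n \<omega>) \<le> \<bar>g \<omega>\<bar>"
          unfolding d using max_birkhoff_nonneg[of g n "\<sigma> \<omega>"] by auto
      qed
      show "AE \<omega> in M. (\<lambda>n. ?d n \<omega>) \<longlonglongrightarrow> g \<omega>"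
        using AE_E
      proof eventually_elim
        case (elim \<omega>)
        obtain k :: nat where k: "- g \<omega> < k" using reals_Archimedean2 by blast
        obtain n0 where n0: "real k < ?m n0 (\<sigma> \<omega>)" using elim shift[of \<omega>] unfolding E_def by blast
        have "?d n \<omega> = g \<omega>" if "n \<ge> n0" for n
          using k n0 max_birkhoff_mono[OF that, of g "\<sigma> \<omega>"] unfolding d by linarith
        then show ?case
          by (intro tendsto_eventually) (auto simp: eventually_sequentially)
      qed
    qed
    \<comment> \<open>Invariance of the measure removes \<sigma> from the second term; what remains
      is an increment of the increasing running maxima.\<close>
    moreover have "(\<integral>\<omega>. ?d n \<omega> \<partial>M) \<ge> 0" for n
    proof -
      have i: "integrable M (?m k)" for k by (rule integrable_max_birkhoff[OF g])
      have "(\<integral>\<omega>. ?d n \<omega> \<partial>M) = (\<integral>\<omega>. ?m (Suc n) \<omega> \<partial>M) - (\<integral>\<omega>. ?m n (\<sigma> \<omega>) \<partial>M)"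
        using i integrable_sigma[OF i] by (intro Bochner_Integration.integral_diff)
      also have "\<dots> = (\<integral>\<omega>. ?m (Suc n) \<omega> \<partial>M) - (\<integral>\<omega>. ?m n \<omega> \<partial>M)"
        using integral_sigma[OF i] by simp
      also have "\<dots> \<ge> 0"
        using integral_mono[OF i i max_birkhoff_le_Suc] by (simp del: max_birkhoff.simps)
      finally show ?thesis .
    qed
    ultimately have "(\<integral>\<omega>. g \<omega> \<partial>M) \<ge> 0" using LIMSEQ_le_const by blast
    with neg show False by simp
  qed
  ultimately have "AE \<omega> in M. \<omega> \<notin> E" using prob_eq_0[OF E] by simp
  then show ?thesis
  proof (rule AE_mp, intro AE_I2 impI)
    fix \<omega> assume "\<omega> \<in> space M" "\<omega> \<notin> E"
    then obtain k :: nat where "\<And>n. ?m n \<omega> \<le> k" by (auto simp: E_def not_less)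
    then show "\<exists>B. \<forall>n. (\<Sum>j<n. g ((\<sigma> ^^ j) \<omega>)) \<le> B"
      using birkhoff_sum_le_max_birkhoff order_trans by blast
  qed
qed

text \<open>Subtracting the mean and \<open>1 / real (Suc k)\<close> makes the integral negative, so
  the centred sums stay below some \<open>B\<close>, and \<open>B / n\<close> vanishes. Countably
  many \<open>k\<close> leave a single null set for all \<open>e\<close>.\<close>

lemma AE_birkhoff_average_eventually_less:
  fixes g :: "'w \<Rightarrow> real"
  assumes g: "integrable M g"
  shows "AE \<omega> in M. \<forall>e>0. \<forall>\<^sub>F n in sequentially.
    (\<Sum>j<n. g ((\<sigma> ^^ j) \<omega>)) / n < (\<integral>\<omega>. g \<omega> \<partial>M) + e"
proof -
  define I where "I = (\<integral>\<omega>. g \<omega> \<partial>M)"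
  have "AE \<omega> in M. \<exists>B. \<forall>n. (\<Sum>j<n. g ((\<sigma> ^^ j) \<omega>) - I - 1 / real (Suc k)) \<le> B" for k
    using g by (intro AE_birkhoff_sum_bounded_above) (auto simp: I_def prob_space)
  then have "AE \<omega> in M. \<forall>k. \<exists>B. \<forall>n. (\<Sum>j<n. g ((\<sigma> ^^ j) \<omega>) - I - 1 / real (Suc k)) \<le> B"
    by (simp add: AE_all_countable)
  then show ?thesis
  proof eventually_elim
    case (elim \<omega>)
    show ?case
    proof (intro allI impI)
      fix e :: real assume e: "e > 0"
      obtain k where "inverse (real (Suc k)) < e / 2"
        using reals_Archimedean[of "e / 2"] e by auto
      then have k: "1 / real (Suc k) < e / 2" by (simp add: inverse_eq_divide)
      obtain B where B: "\<And>n. (\<Sum>j<n. g ((\<sigma> ^^ j) \<omega>) - I - 1 / real (Suc k)) \<le> B"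
        using elim by blast
      have *: "(\<Sum>j<n. g ((\<sigma> ^^ j) \<omega>)) / n < I + e" if n: "n > 0" "B / n < e / 2" for n :: nat
      proof -
        have "(\<Sum>j<n. g ((\<sigma> ^^ j) \<omega>)) - n * (I + 1 / real (Suc k)) \<le> B"
          using B[of n] by (simp add: sum_subtractf algebra_simps)
        then have "(\<Sum>j<n. g ((\<sigma> ^^ j) \<omega>)) \<le> B + n * (I + 1 / real (Suc k))" by simp
        then have "(\<Sum>j<n. g ((\<sigma> ^^ j) \<omega>)) / n \<le> (B + n * (I + 1 / real (Suc k))) / n"
          by (intro divide_right_mono) auto
        also have "\<dots> = B / n + I + 1 / real (Suc k)" using n by (simp add: field_simps)
        finally show ?thesis using k n by linarith
      qed
      have "\<forall>\<^sub>F n in sequentially. B / real n < e / 2"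
        by (rule order_tendstoD[OF lim_const_over_n]) (use e in simp)
      then show "\<forall>\<^sub>F n in sequentially.
          (\<Sum>j<n. g ((\<sigma> ^^ j) \<omega>)) / n < (\<integral>\<omega>. g \<omega> \<partial>M) + e"
        unfolding I_def[symmetric] using eventually_gt_at_top[of "0::nat"]
        by eventually_elim (rule *)
    qed
  qed
qed

theorem birkhoff:
  fixes g :: "'w \<Rightarrow> real"
  assumes g: "integrable M g"
  shows "AE \<omega> in M. (\<lambda>n. (\<Sum>j<n. g ((\<sigma> ^^ j) \<omega>)) / n) \<longlonglongrightarrow> (\<integral>\<omega>. g \<omega> \<partial>M)"
proof -
  have "integrable M (\<lambda>\<omega>. - g \<omega>)" using g by simp
  from AE_birkhoff_average_eventually_less[OF g] AE_birkhoff_average_eventually_less[OF this]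
  show ?thesis
  proof eventually_elim
    case (elim \<omega>)
    show ?case
    proof (rule order_tendstoI)
      fix a assume "a < (\<integral>\<omega>. g \<omega> \<partial>M)"
      then have "\<forall>\<^sub>F n in sequentially.
          (\<Sum>j<n. - g ((\<sigma> ^^ j) \<omega>)) / n < (\<integral>\<omega>. - g \<omega> \<partial>M) + ((\<integral>\<omega>. g \<omega> \<partial>M) - a)"
        using elim(2) diff_gt_0_iff_gt by blast
      then show "\<forall>\<^sub>F n in sequentially. a < (\<Sum>j<n. g ((\<sigma> ^^ j) \<omega>)) / n"
        by (simp add: sum_negf)
    next
      fix a assume "(\<integral>\<omega>. g \<omega> \<partial>M) < a"
      then show "\<forall>\<^sub>F n in sequentially. (\<Sum>j<n. g ((\<sigma> ^^ j) \<omega>)) / n < a"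
        using elim(1)[rule_format, of "a - (\<integral>\<omega>. g \<omega> \<partial>M)"] by simp
    qed
  qed
qed

text \<open>The last term is a difference of consecutive Birkhoff sums, whose averages share a
  limit. This disposes of the boundary terms in \<open>almost_additive_ergodic\<close>.\<close>

lemma AE_funpow_over_n_tendsto_0:
  fixes g :: "'w \<Rightarrow> real"
  assumes g: "integrable M g"
  shows "AE \<omega> in M. (\<lambda>n. g ((\<sigma> ^^ n) \<omega>) / n) \<longlonglongrightarrow> 0"
  using birkhoff[OF g]
proof eventually_elim
  case (elim \<omega>)
  let ?S = "\<lambda>n. \<Sum>j<n. g ((\<sigma> ^^ j) \<omega>)" and ?I = "\<integral>\<omega>. g \<omega> \<partial>M"
  have "(\<lambda>n. ?S (Suc n) / real (Suc n) * (real (Suc n) / real n) - ?S n / n) \<longlonglongrightarrow> ?I * 1 - ?I"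
    by (intro tendsto_diff tendsto_mult LIMSEQ_Suc_n_over_n elim LIMSEQ_Suc[OF elim])
  \<comment> \<open>The case \<open>n = 0\<close> is included: both sides are 0 because division by
    0 yields 0.\<close>
  moreover have "?S (Suc n) / real (Suc n) * (real (Suc n) / real n) - ?S n / n
      = g ((\<sigma> ^^ n) \<omega>) / n" for n
  proof -
    have "?S (Suc n) / real (Suc n) * (real (Suc n) / real n) = ?S (Suc n) / real n"
      by (simp del: of_nat_Suc sum.lessThan_Suc)
    then show ?thesis by (simp add: add_divide_distrib)
  qed
  ultimately show ?case by simp
qed

end

section \<open>Lower and upper maps and water maps\<close>

lemma End1_real_step: "G \<in> End1_real \<Longrightarrow> G (x + 1) = G x + 1"
  by (simp add: End1_real_def)

lemma End1_real_continuous: "G \<in> End1_real \<Longrightarrow> continuous_on S G"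
  by (auto simp: End1_real_def intro: continuous_on_subset)

lemma End1_real_isCont: "G \<in> End1_real \<Longrightarrow> isCont G x"
  by (simp add: End1_real_def continuous_on_eq_continuous_at)

lemma End1_real_add_of_int:
  assumes "G \<in> End1_real"
  shows "G (x + of_int k) = G x + of_int k"
proof -
  have nat: "G (x + of_nat n) = G x + of_nat n" for x n
  proof (induction n)
    case (Suc n)
    then show ?case using End1_real_step[OF assms, of "x + of_nat n"] by (simp add: ac_simps)
  qed simp
  show ?thesis
    using nat[of x "nat k"] nat[of "x + of_int k" "nat (- k)"] by (cases "k \<ge> 0") simp_all
qed

lemma End1_real_comp: "G \<in> End1_real \<Longrightarrow> H \<in> End1_real \<Longrightarrow> G \<circ> H \<in> End1_real"
  unfolding End1_real_def using continuous_on_compose[of UNIV H G]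
  by (auto intro: continuous_on_subset)

lemma End1_real_id: "id \<in> End1_real"
  by (simp add: End1_real_def continuous_on_id)

lemma apply_displacement:
  assumes "G \<in> End1_real"
  shows "apply_bcontfun (displacement G) x = G x - x"
  unfolding displacement_def using displacement_bcontfun[OF assms] by (simp add: Bcontfun_inverse)

lemma abs_diff_le_norm_displacement:
  assumes "G \<in> End1_real"
  shows "\<bar>G x - x\<bar> \<le> norm (displacement G)"
  using norm_bounded[of "displacement G" x] apply_displacement[OF assms] by simp

text \<open>With k the floor of \<open>x - y\<close>, monotonicity traps \<open>G x\<close> between
  \<open>G y + k\<close> and \<open>G y + k + 1\<close>, and \<open>x - y\<close> lies between k and
  \<open>k + 1\<close> as well. Every constant 1 in the later estimates comes from here.\<close>

lemma mono_End1_displacement_diff: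
  assumes G: "G \<in> End1_real" "mono G"
  shows "\<bar>(G x - x) - (G y - y)\<bar> \<le> 1"
proof -
  define k where "k = \<lfloor>x - y\<rfloor>"
  have "G (y + of_int k) \<le> G x" "G x \<le> G (y + of_int (k + 1))"
    by (intro monoD[OF G(2)]; unfold k_def; linarith)+
  moreover have "of_int k \<le> x - y" "x - y < of_int k + 1"
    unfolding k_def by linarith+
  ultimately show ?thesis
    using End1_real_add_of_int[OF G(1), of y k] End1_real_add_of_int[OF G(1), of y "k + 1"]
    by (simp add: abs_le_iff)
qed

section \<open>Upper envelopes of degree-one maps\<close>

context
  fixes F :: "'w \<Rightarrow> real \<Rightarrow> real" and \<omega> :: 'w
  assumes F: "F \<omega> \<in> End1_real"
begin

lemma upper_map_bdd: "bdd_above (F \<omega> ` {..x})"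
proof (rule bdd_aboveI2)
  fix y assume "y \<in> {..x}"
  then show "F \<omega> y \<le> x + norm (displacement (F \<omega>))"
    using abs_diff_le_norm_displacement[OF F, of y] by auto
qed

lemma upper_map_le_iff: "upper_map F \<omega> x \<le> c \<longleftrightarrow> (\<forall>y\<le>x. F \<omega> y \<le> c)"
  unfolding upper_map_def using upper_map_bdd by (subst cSUP_le_iff) auto

lemma le_upper_map: "y \<le> x \<Longrightarrow> F \<omega> y \<le> upper_map F \<omega> x"
  using upper_map_le_iff[of x "upper_map F \<omega> x"] by simp

lemma mono_upper_map: "mono (upper_map F \<omega>)"
  by (rule monoI) (auto simp: upper_map_le_iff intro: le_upper_map)

lemma upper_map_step: "upper_map F \<omega> (x + 1) = upper_map F \<omega> x + 1"
proof (rule antisym)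
  show "upper_map F \<omega> (x + 1) \<le> upper_map F \<omega> x + 1"
    unfolding upper_map_le_iff
  proof (intro allI impI)
    fix y assume "y \<le> x + 1"
    then show "F \<omega> y \<le> upper_map F \<omega> x + 1"
      using le_upper_map[of "y - 1" x] End1_real_step[OF F, of "y - 1"] by simp
  qed
  have "upper_map F \<omega> x \<le> upper_map F \<omega> (x + 1) - 1"
    unfolding upper_map_le_iff
  proof (intro allI impI)
    fix y assume "y \<le> x"
    then show "F \<omega> y \<le> upper_map F \<omega> (x + 1) - 1"
      using le_upper_map[of "y + 1" "x + 1"] End1_real_step[OF F, of y] by simp
  qed
  then show "upper_map F \<omega> x + 1 \<le> upper_map F \<omega> (x + 1)" by simp
qed

text \<open>Moving the end of the ray to the right adds only a segment to the supremum. This serves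
  the continuity proof and the rightmost-point argument for water maps.\<close>

lemma upper_map_extend:
  assumes "upper_map F \<omega> x \<le> c" and "\<And>y. x \<le> y \<Longrightarrow> y \<le> z \<Longrightarrow> F \<omega> y \<le> c"
  shows "upper_map F \<omega> z \<le> c"
  unfolding upper_map_le_iff using assms upper_map_le_iff[of x c] by (meson linear)

lemma isCont_upper_map: "isCont (upper_map F \<omega>) x"
  unfolding continuous_at_real_range real_norm_def
proof (intro allI impI)
  fix e :: real assume e: "e > 0"
  obtain d where d: "d > 0" "\<And>y. \<bar>y - x\<bar> < d \<Longrightarrow> \<bar>F \<omega> y - F \<omega> x\<bar> < e / 3"
    using End1_real_isCont[OF F, of x, unfolded continuous_at_real_range, rule_format, of "e / 3"] e
    by auto
  have "\<bar>upper_map F \<omega> y - upper_map F \<omega> x\<bar> < e" if y: "\<bar>y - x\<bar> < d" for y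
  proof (cases "x \<le> y")
    case True
    have "upper_map F \<omega> y \<le> upper_map F \<omega> x + e / 3"
    proof (rule upper_map_extend[where x=x])
      fix z assume "x \<le> z" "z \<le> y"
      then have "\<bar>F \<omega> z - F \<omega> x\<bar> < e / 3" using y by (intro d) auto
      then show "F \<omega> z \<le> upper_map F \<omega> x + e / 3" using le_upper_map[of x x] e by linarith
    qed (use e in simp)
    then show ?thesis using monoD[OF mono_upper_map True] e by linarith
  next
    case False
    \<comment> \<open>Here the added segment ends at \<open>x\<close>, so
      \<open>F \<omega> z\<close> is compared with \<open>F \<omega> y\<close> through
      \<open>F \<omega> x\<close>, at a cost of \<open>e / 3\<close> each.\<close>
    have "upper_map F \<omega> x \<le> upper_map F \<omega> y + 2 * e / 3"
    proof (rule upper_map_extend[where x=y])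
      fix z assume "y \<le> z" "z \<le> x"
      then have "\<bar>F \<omega> z - F \<omega> x\<bar> < e / 3" using y by (intro d) auto
      moreover have "\<bar>F \<omega> y - F \<omega> x\<bar> < e / 3" using y by (intro d) auto
      ultimately show "F \<omega> z \<le> upper_map F \<omega> y + 2 * e / 3" using le_upper_map[of y y] by linarith
    qed (use e in simp)
    then show ?thesis using monoD[OF mono_upper_map, of y x] False e by linarith
  qed
  then show "\<exists>d>0. \<forall>y. \<bar>y - x\<bar> < d \<longrightarrow> \<bar>upper_map F \<omega> y - upper_map F \<omega> x\<bar> < e"
    using d by blast
qed

lemma upper_map_End1: "upper_map F \<omega> \<in> End1_real"
  by (simp add: End1_real_def upper_map_step continuous_on_eq_continuous_at isCont_upper_map)

end

section \<open>Lower envelopes, by reflection\<close>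

lemma reflect_End1: "G \<in> End1_real \<Longrightarrow> (\<lambda>x. - G (- x)) \<in> End1_real"
proof -
  assume G: "G \<in> End1_real"
  have "- G (- (x + 1)) = - G (- x) + 1" for x
    using End1_real_step[OF G, of "- x - 1"] by simp
  moreover have "continuous_on UNIV (\<lambda>x. - G (- x))"
    by (intro continuous_on_minus continuous_on_compose2[OF End1_real_continuous[OF G, of UNIV]]
        continuous_on_id) simp
  ultimately show ?thesis unfolding End1_real_def by blast
qed

text \<open>Reflection turns infima over right rays into suprema over left rays, so that lower maps
  inherit continuity and the degree-one property from upper maps.\<close>

lemma lower_map_eq_upper_map: "lower_map F \<omega> x = - upper_map (\<lambda>\<omega> x. - F \<omega> (- x)) \<omega> (- x)"
proof -
  have "uminus ` F \<omega> ` {x..} = (\<lambda>y. - F \<omega> (- y)) ` uminus ` {x..}"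
    by (simp only: image_image minus_minus)
  then show ?thesis by (simp add: lower_map_def upper_map_def Inf_real_def)
qed

context
  fixes F :: "'w \<Rightarrow> real \<Rightarrow> real" and \<omega> :: 'w
  assumes F: "F \<omega> \<in> End1_real"
begin

lemma le_lower_map_iff: "c \<le> lower_map F \<omega> x \<longleftrightarrow> (\<forall>y\<ge>x. c \<le> F \<omega> y)"
proof -
  have "c \<le> lower_map F \<omega> x \<longleftrightarrow> (\<forall>y\<le>- x. - F \<omega> (- y) \<le> - c)"
    using upper_map_le_iff[of "\<lambda>\<omega> x. - F \<omega> (- x)", OF reflect_End1[OF F], of "- x" "- c"]
    unfolding lower_map_eq_upper_map by auto
  also have "\<dots> \<longleftrightarrow> (\<forall>y\<ge>x. c \<le> F \<omega> y)"
  proof (intro iffI allI impI)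
    show "c \<le> F \<omega> y" if "\<forall>y\<le>- x. - F \<omega> (- y) \<le> - c" "x \<le> y" for y
      using that(1)[rule_format, of "- y"] that(2) by simp
  qed auto
  finally show ?thesis .
qed

lemma lower_map_le: "x \<le> y \<Longrightarrow> lower_map F \<omega> x \<le> F \<omega> y"
  using le_lower_map_iff[of "lower_map F \<omega> x" x] by simp

lemma mono_lower_map: "mono (lower_map F \<omega>)"
  by (rule monoI) (auto simp: le_lower_map_iff intro: lower_map_le)

lemma lower_map_End1: "lower_map F \<omega> \<in> End1_real"
proof -
  have "lower_map F \<omega> = (\<lambda>x. - upper_map (\<lambda>\<omega> x. - F \<omega> (- x)) \<omega> (- x))"
    by (simp add: fun_eq_iff lower_map_eq_upper_map)
  then show ?thesis
    using reflect_End1[OF upper_map_End1[of "\<lambda>\<omega> x. - F \<omega> (- x)", OF reflect_End1[OF F]]] by simp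
qed

text \<open>Just to the right of \<open>b\<close>, \<open>F \<omega>\<close> stays above the infimum
  by a fixed margin, so dropping this initial segment of the ray leaves the infimum
  unchanged.\<close>

lemma lower_map_flat:
  assumes "lower_map F \<omega> b < F \<omega> b"
  shows "\<exists>d>0. \<forall>x. b \<le> x \<and> x \<le> b + d \<longrightarrow> lower_map F \<omega> x = lower_map F \<omega> b"
proof -
  define m where "m = (lower_map F \<omega> b + F \<omega> b) / 2"
  have m: "lower_map F \<omega> b < m" "m < F \<omega> b" using assms by (auto simp: m_def)
  have "\<forall>\<^sub>F y in at b. m < F \<omega> y"
    using End1_real_isCont[OF F, of b] m(2) unfolding isCont_def by (rule order_tendstoD)
  then obtain d where d: "d > 0" "\<And>y. y \<noteq> b \<Longrightarrow> dist y b < d \<Longrightarrow> m < F \<omega> y"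
    unfolding eventually_at by auto
  have "lower_map F \<omega> x = lower_map F \<omega> b" if x: "b \<le> x" "x \<le> b + d / 2" for x
  proof -
    \<comment> \<open>As \<open>m\<close> exceeds \<open>lower_map F \<omega> b\<close>, it must be
      the other argument of the minimum that lies below.\<close>
    have "min m (lower_map F \<omega> x) \<le> lower_map F \<omega> b"
      unfolding le_lower_map_iff
    proof (intro allI impI)
      fix y assume y: "b \<le> y"
      show "min m (lower_map F \<omega> x) \<le> F \<omega> y"
      proof (cases "y < x")
        case True
        then have "m < F \<omega> y"
          using y m(2) x d(1) d(2)[of y] by (cases "y = b") (auto simp: dist_real_def)
        then show ?thesis by simp
      next
        case False
        then show ?thesis using lower_map_le[of x y] by linarith
      qed
    qed
    then show ?thesis using m monoD[OF mono_lower_map x(1)] by linarith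
  qed
  then show ?thesis using d(1) half_gt_zero by blast
qed

end

section \<open>Truncations and the monotone maps built from them\<close>

definition truncated_map :: "('w \<Rightarrow> real \<Rightarrow> real) \<Rightarrow> ('w \<Rightarrow> real) \<Rightarrow> 'w \<Rightarrow> real \<Rightarrow> real" where
  "truncated_map F s \<omega> x = min (F \<omega> x) (lower_map F \<omega> x + s \<omega>)"

definition water_map :: "('w \<Rightarrow> real \<Rightarrow> real) \<Rightarrow> ('w \<Rightarrow> real) \<Rightarrow> 'w \<Rightarrow> real \<Rightarrow> real" where
  "water_map F s = upper_map (truncated_map F s)"

context
  fixes F :: "'w \<Rightarrow> real \<Rightarrow> real" and \<omega> :: 'w
  assumes F: "F \<omega> \<in> End1_real"
begin

lemma truncated_map_End1: "truncated_map F s \<omega> \<in> End1_real"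
proof -
  have "truncated_map F s \<omega> = (\<lambda>x. min (F \<omega> x) (lower_map F \<omega> x + s \<omega>))"
    by (auto simp: truncated_map_def)
  then show ?thesis
    using F lower_map_End1[of F \<omega>, OF F] by (auto simp: End1_real_def intro!: continuous_intros)
qed

lemma water_map_End1: "water_map F s \<omega> \<in> End1_real"
  unfolding water_map_def by (rule upper_map_End1[of "truncated_map F s" \<omega>, OF truncated_map_End1])

lemma mono_water_map: "mono (water_map F s \<omega>)"
  unfolding water_map_def by (rule mono_upper_map[of "truncated_map F s" \<omega>, OF truncated_map_End1])

lemma truncated_le_water_map: "y \<le> x \<Longrightarrow> truncated_map F s \<omega> y \<le> water_map F s \<omega> x"
  unfolding water_map_def by (rule le_upper_map[of "truncated_map F s" \<omega>, OF truncated_map_End1])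

lemma water_map_le_iff: "water_map F s \<omega> x \<le> c \<longleftrightarrow> (\<forall>y\<le>x. truncated_map F s \<omega> y \<le> c)"
  unfolding water_map_def by (rule upper_map_le_iff[of "truncated_map F s" \<omega>, OF truncated_map_End1])

text \<open>Raising the level raises the truncation pointwise by at most the same amount, and
  suprema keep such bounds. This Lipschitz dependence is behind the continuity in the
  parameter.\<close>

lemma water_map_mono_level:
  assumes "s \<omega> \<le> s' \<omega>"
  shows "water_map F s \<omega> x \<le> water_map F s' \<omega> x"
    and "water_map F s' \<omega> x \<le> water_map F s \<omega> x + (s' \<omega> - s \<omega>)"
proof -
  have "truncated_map F s \<omega> y \<le> water_map F s' \<omega> x" if "y \<le> x" for y
    using assms truncated_le_water_map[OF that, of s'] by (auto simp: truncated_map_def)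
  then show "water_map F s \<omega> x \<le> water_map F s' \<omega> x"
    by (simp add: water_map_le_iff)
  have "truncated_map F s' \<omega> y \<le> water_map F s \<omega> x + (s' \<omega> - s \<omega>)" if "y \<le> x" for y
    using assms truncated_le_water_map[OF that, of s] by (auto simp: truncated_map_def)
  then show "water_map F s' \<omega> x \<le> water_map F s \<omega> x + (s' \<omega> - s \<omega>)"
    by (simp add: water_map_le_iff)
qed

lemma water_map_le_upper: "water_map F s \<omega> x \<le> upper_map F \<omega> x"
  unfolding water_map_le_iff truncated_map_def
  using le_upper_map[of F \<omega>, OF F] by (auto simp: min_le_iff_disj)

lemma lower_le_water_map:
  assumes "0 \<le> s \<omega>"
  shows "lower_map F \<omega> x \<le> water_map F s \<omega> x"
proof -
  have "lower_map F \<omega> x \<le> truncated_map F s \<omega> x"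
    using assms lower_map_le[of F \<omega>, OF F, of x x] by (auto simp: truncated_map_def)
  then show ?thesis using truncated_le_water_map[of x x s] by simp
qed

lemma water_map_zero:
  assumes "s \<omega> = 0"
  shows "water_map F s \<omega> x = lower_map F \<omega> x"
proof (rule antisym)
  show "water_map F s \<omega> x \<le> lower_map F \<omega> x"
    unfolding water_map_le_iff using assms monoD[OF mono_lower_map[of F \<omega>, OF F]]
    by (auto simp: truncated_map_def min_le_iff_disj)
qed (use lower_le_water_map assms in simp)

lemma upper_map_displacement_le:
  assumes "\<And>y. F \<omega> y \<le> y + N"
  shows "upper_map F \<omega> x \<le> x + N"
  unfolding upper_map_le_iff[of F \<omega>, OF F]
proof (intro allI impI)
  show "F \<omega> y \<le> x + N" if "y \<le> x" for y using assms[of y] that by simp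
qed

lemma lower_map_displacement_ge:
  assumes "\<And>y. y - N \<le> F \<omega> y"
  shows "x - N \<le> lower_map F \<omega> x"
  unfolding le_lower_map_iff[of F \<omega>, OF F]
proof (intro allI impI)
  show "x - N \<le> F \<omega> y" if "x \<le> y" for y using assms[of y] that by simp
qed

text \<open>\<open>F \<omega>\<close> is at most \<open>N\<close> above the identity and its lower
  map at most \<open>N\<close> below, so a level of \<open>2 * N\<close> cuts nothing off. This is
  the origin of the factor 2 in \<open>level\<close>.\<close>

lemma water_map_full:
  assumes N: "\<And>y. \<bar>F \<omega> y - y\<bar> \<le> N" and s: "2 * N \<le> s \<omega>"
  shows "water_map F s \<omega> x = upper_map F \<omega> x"
proof -
  have low: "y - N \<le> F \<omega> y" for y using N[of y] by linarith
  have "F \<omega> y \<le> lower_map F \<omega> y + s \<omega>" for y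
    using lower_map_displacement_ge[of N y, OF low] N[of y] s by linarith
  then have "truncated_map F s \<omega> y = F \<omega> y" for y by (simp add: truncated_map_def)
  then show ?thesis by (simp add: water_map_def upper_map_def)
qed

lemma water_map_displacement:
  assumes N: "\<And>y. \<bar>F \<omega> y - y\<bar> \<le> N" and s: "0 \<le> s \<omega>"
  shows "\<bar>water_map F s \<omega> x - x\<bar> \<le> N"
proof -
  have "y - N \<le> F \<omega> y" "F \<omega> y \<le> y + N" for y using N[of y] by linarith+
  then have "x - N \<le> lower_map F \<omega> x" "upper_map F \<omega> x \<le> x + N"
    by (simp_all add: lower_map_displacement_ge upper_map_displacement_le)
  then show ?thesis
    using lower_le_water_map[of s, OF s, of x] water_map_le_upper[of s x] by linarith
qed

text \<open>The rightmost point of a level set of the water map works: to the right of a point where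
  the truncation is strict, the truncated map is locally constant.\<close>

lemma water_map_eq_surj:
  assumes s: "0 \<le> s \<omega>"
  shows "\<exists>x. water_map F s \<omega> x = v \<and> F \<omega> x = v"
proof -
  let ?W = "water_map F s \<omega>" and ?H = "truncated_map F s \<omega>"
  define N where "N = norm (displacement (F \<omega>))"
  have N: "\<bar>?W x - x\<bar> \<le> N" for x
    using water_map_displacement[of N s] abs_diff_le_norm_displacement[OF F] s by (auto simp: N_def)
  define b where "b = Sup {x. ?W x \<le> v}"
  have ne: "v - N \<in> {x. ?W x \<le> v}" using N[of "v - N"] by auto
  have bdd: "bdd_above {x. ?W x \<le> v}"
  proof (rule bdd_aboveI)
    fix x assume "x \<in> {x. ?W x \<le> v}"
    then show "x \<le> v + N" using N[of x] by auto
  qed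
  have "closed {x. ?W x \<le> v}"
    using End1_real_continuous[OF water_map_End1, of UNIV s]
    by (intro closed_Collect_le continuous_on_const)
  then have Wb: "?W b \<le> v"
    using closed_contains_Sup[OF _ bdd] ne unfolding b_def by blast
  have right: "v < ?W x" if "b < x" for x
    using cSup_upper[OF _ bdd, of x] that unfolding b_def by fastforce
  \<comment> \<open>Maximality of \<open>b\<close>: a segment to its right on which the truncation
    stays at or below \<open>v\<close> would belong to the same sublevel set of the water
    map.\<close>
  have no_flat: False if d: "d > 0" "\<And>y. b \<le> y \<Longrightarrow> y \<le> b + d \<Longrightarrow> ?H y \<le> v" for d
  proof -
    have "?W (b + d) \<le> v"
      using upper_map_extend[of "truncated_map F s" \<omega> b v "b + d", OF truncated_map_End1] Wb d(2)
      unfolding water_map_def by blast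
    then show False using right[of "b + d"] d(1) by simp
  qed
  have "?H b = v"
  proof (rule ccontr)
    assume "?H b \<noteq> v"
    then have "?H b < v" using Wb truncated_le_water_map[of b b s] by simp
    then have "\<forall>\<^sub>F y in at b. ?H y < v"
      using End1_real_isCont[OF truncated_map_End1, of b s] unfolding isCont_def
      by (rule order_tendstoD(2)[rotated])
    then obtain d where d: "d > 0" "\<And>y. y \<noteq> b \<Longrightarrow> dist y b < d \<Longrightarrow> ?H y < v"
      unfolding eventually_at by auto
    have "?H y \<le> v" if "b \<le> y" "y \<le> b + d / 2" for y
      using d(1) d(2)[of y] that \<open>?H b < v\<close> by (cases "y = b") (auto simp: dist_real_def)
    then show False using no_flat[of "d / 2"] d(1) by simp
  qed
  moreover have "F \<omega> b = ?H b"
  proof (rule ccontr)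
    assume "F \<omega> b \<noteq> ?H b"
    \<comment> \<open>Because the level is nonnegative, strict truncation at \<open>b\<close> puts
      \<open>F \<omega> b\<close> strictly above the lower map, as \<open>lower_map_flat\<close>
      requires.\<close>
    then have lt: "lower_map F \<omega> b < F \<omega> b" and eq: "?H b = lower_map F \<omega> b + s \<omega>"
      using s by (auto simp: truncated_map_def min_def split: if_splits)
    obtain d where d: "d > 0" "\<And>x. b \<le> x \<Longrightarrow> x \<le> b + d \<Longrightarrow> lower_map F \<omega> x = lower_map F \<omega> b"
      using lower_map_flat[of F \<omega>, OF F lt] by blast
    have "?H x \<le> v" if "b \<le> x" "x \<le> b + d" for x
    proof -
      have "?H x \<le> lower_map F \<omega> x + s \<omega>" by (simp add: truncated_map_def)
      then show ?thesis using d(2)[OF that] eq \<open>?H b = v\<close> by simp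
    qed
    then show False using no_flat d(1) by blast
  qed
  moreover have "?W b = v" using Wb truncated_le_water_map[of b b s] \<open>?H b = v\<close> by simp
  ultimately show ?thesis by auto
qed

end

section \<open>Rotation numbers of monotone random lifts\<close>

lemma abs_sum_diff_le:
  fixes f g :: "'b \<Rightarrow> real" and C :: real
  assumes "\<And>i. i \<in> S \<Longrightarrow> \<bar>f i - g i\<bar> \<le> C"
  shows "\<bar>sum f S - sum g S\<bar> \<le> card S * C"
proof -
  have "\<bar>sum f S - sum g S\<bar> \<le> (\<Sum>i\<in>S. \<bar>f i - g i\<bar>)"
    by (simp add: sum_subtractf[symmetric] sum_abs)
  also have "\<dots> \<le> card S * C" by (rule sum_bounded_above) (use assms in auto)
  finally show ?thesis .
qed

text \<open>Telescoping in two ways: \<open>a k (\<sigma> ^ j \<omega>)\<close> is close to \<open>a (j + k) \<omega> - a j \<omega>\<close>, whose sum over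
  \<open>j < n\<close> equals the sum of \<open>a (n + i) \<omega> - a i \<omega>\<close> over \<open>i < k\<close>.\<close>

lemma almost_additive_birkhoff_sum:
  fixes a :: "nat \<Rightarrow> 'w \<Rightarrow> real" and C :: real
  assumes "\<And>m n. \<bar>a (n + m) \<omega> - a n \<omega> - a m ((\<sigma> ^^ n) \<omega>)\<bar> \<le> C"
  shows "\<bar>(\<Sum>j<n. a k ((\<sigma> ^^ j) \<omega>)) - (k * a n \<omega> + (\<Sum>i<k. a i ((\<sigma> ^^ n) \<omega>) - a i \<omega>))\<bar>
    \<le> (real n + real k) * C"
proof -
  have tele: "(\<Sum>j<n. a (j + k) \<omega> - a j \<omega>) = (\<Sum>i<k. a (n + i) \<omega> - a i \<omega>)"
  proof (induction n)
    case (Suc n)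
    have "(\<Sum>i<k. a (Suc n + i) \<omega>) + a n \<omega> = (\<Sum>i<Suc k. a (n + i) \<omega>)"
      by (simp only: sum.lessThan_Suc_shift) simp
    then show ?case using Suc by (simp add: sum_subtractf algebra_simps)
  qed simp
  have "\<bar>(\<Sum>j<n. a k ((\<sigma> ^^ j) \<omega>)) - (\<Sum>j<n. a (j + k) \<omega> - a j \<omega>)\<bar> \<le> card {..<n} * C"
    using assms by (intro abs_sum_diff_le) (simp add: abs_minus_commute algebra_simps)
  \<comment> \<open>A second use of almost additivity, now for the \<open>k\<close> terms at the far
    end; it contributes the summand \<open>real k * C\<close> to the bound.\<close>
  moreover have "\<bar>(\<Sum>i<k. a (n + i) \<omega> - a i \<omega>) - (\<Sum>i<k. a n \<omega> + (a i ((\<sigma> ^^ n) \<omega>) - a i \<omega>))\<bar>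
      \<le> card {..<k} * C"
  proof (rule abs_sum_diff_le)
    fix i
    show "\<bar>(a (n + i) \<omega> - a i \<omega>) - (a n \<omega> + (a i ((\<sigma> ^^ n) \<omega>) - a i \<omega>))\<bar> \<le> C"
      using assms[where n=n and m=i] by (simp add: algebra_simps)
  qed
  moreover have "(\<Sum>i<k. a n \<omega> + (a i ((\<sigma> ^^ n) \<omega>) - a i \<omega>))
      = k * a n \<omega> + (\<Sum>i<k. a i ((\<sigma> ^^ n) \<omega>) - a i \<omega>)"
    by (simp add: sum.distrib)
  ultimately show ?thesis unfolding tele by (simp add: algebra_simps)
qed

context ergodic_pmps
begin

text \<open>Dividing \<open>almost_additive_birkhoff_sum\<close> by \<open>k * n\<close> puts
  \<open>a n \<omega> / n\<close> eventually within \<open>C / k + e\<close> of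
  \<open>I k / k\<close>. Large \<open>k\<close> makes the sequence Cauchy, and limits at different
  points agree because all lie within \<open>C / k\<close> of the same number.\<close>

theorem almost_additive_ergodic:
  fixes a :: "nat \<Rightarrow> 'w \<Rightarrow> real" and C :: real
  assumes int: "\<And>n. integrable M (a n)"
    and add: "\<And>m n \<omega>. \<omega> \<in> space M \<Longrightarrow> \<bar>a (n + m) \<omega> - a n \<omega> - a m ((\<sigma> ^^ n) \<omega>)\<bar> \<le> C"
  shows "\<exists>r. (\<forall>k>0. \<bar>r - (\<integral>\<omega>. a k \<omega> \<partial>M) / k\<bar> \<le> C / k) \<and> (AE \<omega> in M. (\<lambda>n. a n \<omega> / n) \<longlonglongrightarrow> r)"
proof -
  define I where "I k = (\<integral>\<omega>. a k \<omega> \<partial>M)" for k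
  define good where "good \<omega> \<longleftrightarrow> (\<forall>k>0. \<forall>e>0. \<forall>\<^sub>F n in sequentially.
      \<bar>a n \<omega> / n - I k / k\<bar> < C / k + e)" for \<omega>
  have "AE \<omega> in M. \<forall>k. (\<lambda>n. (\<Sum>j<n. a k ((\<sigma> ^^ j) \<omega>)) / n) \<longlonglongrightarrow> I k"
    unfolding AE_all_countable I_def using birkhoff[OF int] by blast
  moreover have "AE \<omega> in M. \<forall>k. (\<lambda>n. a k ((\<sigma> ^^ n) \<omega>) / n) \<longlonglongrightarrow> 0"
    unfolding AE_all_countable using AE_funpow_over_n_tendsto_0[OF int] by blast
  ultimately have good: "AE \<omega> in M. good \<omega>"
    using AE_space
  proof eventually_elim
    case (elim \<omega>)
    show ?case
      unfolding good_def
    proof (intro allI impI)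
      fix k :: nat and e :: real assume k: "k > 0" and e: "e > 0"
      let ?S = "\<lambda>n. \<Sum>j<n. a k ((\<sigma> ^^ j) \<omega>)"
      let ?T = "\<lambda>n. \<Sum>i<k. a i ((\<sigma> ^^ n) \<omega>) - a i \<omega>"
      define E where "E n = \<bar>?S n / n - I k\<bar> / k + (C / n + \<bar>?T n / n\<bar> / k)" for n :: nat
      have "(\<lambda>n. ?T n / n) \<longlonglongrightarrow> (\<Sum>i<k. 0 - 0)"
        unfolding sum_divide_distrib diff_divide_distrib
        using elim(2) by (intro tendsto_sum tendsto_diff lim_const_over_n) auto
      then have "E \<longlonglongrightarrow> \<bar>I k - I k\<bar> / k + (0 + \<bar>0\<bar> / k)"
        unfolding E_def using elim(1) k
        by (intro tendsto_add tendsto_divide tendsto_rabs tendsto_diff tendsto_const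
            lim_const_over_n) auto
      then have "\<forall>\<^sub>F n in sequentially. E n < e"
        using e by (intro order_tendstoD(2)[where y=0]) auto
      then show "\<forall>\<^sub>F n in sequentially. \<bar>a n \<omega> / n - I k / k\<bar> < C / k + e"
        using eventually_gt_at_top[of 0]
      proof eventually_elim
        case n: (elim n)
        define X where "X = ?S n - (k * a n \<omega> + ?T n)"
        have X: "\<bar>X\<bar> \<le> (real n + real k) * C"
          unfolding X_def
          using almost_additive_birkhoff_sum[of a \<omega> \<sigma> C k n] add elim by blast
        have "a n \<omega> / n - I k / k = (?S n / n - I k) / k - (X / (k * n) + ?T n / n / k)"
          using k n by (simp add: X_def field_simps)
        also have "\<bar>\<dots>\<bar> \<le> \<bar>?S n / n - I k\<bar> / k + (\<bar>X\<bar> / (k * n) + \<bar>?T n / n\<bar> / k)"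
          by (rule order_trans[OF abs_triangle_ineq4 add_mono[OF _ order_trans[OF abs_triangle_ineq]]])
             (auto simp: abs_divide abs_mult)
        also have "\<bar>X\<bar> / (k * n) \<le> (real n + real k) * C / (k * n)"
          using X by (intro divide_right_mono) auto
        also have "(real n + real k) * C / (k * n) = C / k + C / n"
          using k n by (simp add: field_simps)
        finally show ?case using n by (simp add: E_def)
      qed
    qed
  qed
  \<comment> \<open>A probability space is not null, so a good sample point exists; its limit is
    taken as \<open>r\<close>.\<close>
  have "\<not> (AE \<omega> in M. False)" by simp
  then obtain \<omega>0 where \<omega>0: "good \<omega>0" using good by (metis (mono_tags, lifting) AE_mp AE_I2)
  have C: "C \<ge> 0"
  proof -
    obtain \<omega> where "\<omega> \<in> space M" using not_empty by blast
    then show ?thesis using add[of \<omega> 0 0] by linarith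
  qed
  have Cauchy: "Cauchy (\<lambda>n. a n \<omega> / n)" if "good \<omega>" for \<omega>
  proof (rule metric_CauchyI)
    fix e :: real assume e: "e > 0"
    have "\<forall>\<^sub>F k in sequentially. C / real k < e / 4"
      by (rule order_tendstoD[OF lim_const_over_n]) (use e in simp)
    then have "\<forall>\<^sub>F k::nat in sequentially. k > 0 \<and> C / k < e / 4"
      using eventually_gt_at_top[of 0] by eventually_elim simp
    then obtain k :: nat where k: "k > 0" "C / k < e / 4"
      by (auto simp: eventually_sequentially)
    have "\<forall>\<^sub>F n in sequentially. \<bar>a n \<omega> / n - I k / k\<bar> < C / k + e / 4"
      using that k(1) e unfolding good_def by simp
    then obtain N where N: "\<And>n. n \<ge> N \<Longrightarrow> \<bar>a n \<omega> / n - I k / k\<bar> < C / k + e / 4"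
      by (auto simp: eventually_sequentially)
    have "dist (a m \<omega> / m) (a n \<omega> / n) < e" if "m \<ge> N" "n \<ge> N" for m n
      using N[OF that(1)] N[OF that(2)] k(2) unfolding dist_real_def by linarith
    then show "\<exists>N. \<forall>m\<ge>N. \<forall>n\<ge>N. dist (a m \<omega> / m) (a n \<omega> / n) < e" by blast
  qed
  have lim_close: "\<bar>r - I k / k\<bar> \<le> C / k" if "good \<omega>" "(\<lambda>n. a n \<omega> / n) \<longlonglongrightarrow> r" "k > 0" for \<omega> r and k :: nat
  proof (rule field_le_epsilon)
    fix e :: real assume "e > 0"
    then have "\<forall>\<^sub>F n in sequentially. \<bar>a n \<omega> / n - I k / k\<bar> \<le> C / k + e"
      using that unfolding good_def by (auto elim!: allE[of _ k] allE[of _ e] eventually_mono)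
    then show "\<bar>r - I k / k\<bar> \<le> C / k + e"
      using tendsto_rabs[OF tendsto_diff[OF that(2) tendsto_const]]
      by (intro tendsto_upperbound[where F=sequentially]) auto
  qed
  obtain r where r: "(\<lambda>n. a n \<omega>0 / n) \<longlonglongrightarrow> r"
    using Cauchy[OF \<omega>0] Cauchy_convergent_iff convergent_def by blast
  have "(\<lambda>n. a n \<omega> / n) \<longlonglongrightarrow> r" if w: "good \<omega>" for \<omega>
  proof -
    obtain r' where r': "(\<lambda>n. a n \<omega> / n) \<longlonglongrightarrow> r'"
      using Cauchy[OF w] Cauchy_convergent_iff convergent_def by blast
    have "(\<lambda>k. 2 * C / real k) \<longlonglongrightarrow> 0" by (rule lim_const_over_n)
    moreover have "\<forall>\<^sub>F k in sequentially. \<bar>r - r'\<bar> \<le> 2 * C / real k"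
      using eventually_gt_at_top[of 0]
    proof eventually_elim
      case (elim k)
      then show ?case using lim_close[OF \<omega>0 r elim] lim_close[OF w r' elim] by simp
    qed
    ultimately have "\<bar>r - r'\<bar> \<le> 0" by (rule tendsto_lowerbound) simp
    then show ?thesis using r' by simp
  qed
  then show ?thesis
    using good lim_close[OF \<omega>0 r] unfolding I_def by (intro exI[of _ r]) auto
qed

end

section \<open>Cocycles of monotone lifts\<close>

lemma cocycle_add: "cocycle \<sigma> G (n + m) \<omega> = cocycle \<sigma> G m ((\<sigma> ^^ n) \<omega>) \<circ> cocycle \<sigma> G n \<omega>"
  by (induction m) (auto simp: funpow_add add.commute comp_assoc)

text \<open>Measurability at each fixed point passes easily to envelopes. \<open>N\<close> may be
  any integrable majorant, so that all water maps can share one, as dominated convergence in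
  \<open>isCont_rho\<close> requires.\<close>

locale random_monotone = ergodic_pmps M \<sigma> for M :: "'w measure" and \<sigma> +
  fixes G :: "'w \<Rightarrow> real \<Rightarrow> real" and N :: "'w \<Rightarrow> real"
  assumes End1: "\<omega> \<in> space M \<Longrightarrow> G \<omega> \<in> End1_real"
    and mono: "\<omega> \<in> space M \<Longrightarrow> mono (G \<omega>)"
    and measurable_at: "(\<lambda>\<omega>. G \<omega> x) \<in> borel_measurable M"
    and integrable_bound: "integrable M N"
    and displacement_le: "\<omega> \<in> space M \<Longrightarrow> \<bar>G \<omega> x - x\<bar> \<le> N \<omega>"

lemma (in ergodic_pmps) cocycle_End1:
  assumes "\<And>\<omega>. \<omega> \<in> space M \<Longrightarrow> G \<omega> \<in> End1_real" and "\<omega> \<in> space M"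
  shows "cocycle \<sigma> G n \<omega> \<in> End1_real"
proof (induction n)
  case 0
  then show ?case using End1_real_id by (simp add: id_def)
next
  case (Suc n)
  then show ?case using End1_real_comp[OF assms(1)[OF sigma_space[OF assms(2)]]]
    by (simp only: cocycle.simps)
qed

context random_monotone
begin

lemma cocycle_mono: "\<omega> \<in> space M \<Longrightarrow> mono (cocycle \<sigma> G n \<omega>)"
proof (induction n)
  case (Suc n)
  then have "mono (G ((\<sigma> ^^ n) \<omega>))" using mono sigma_space by blast
  then show ?case using Suc by (auto simp: mono_def)
qed (simp add: mono_def)

lemma cocycle_displacement_diff:
  "\<omega> \<in> space M \<Longrightarrow> \<bar>(cocycle \<sigma> G n \<omega> x - x) - cocycle \<sigma> G n \<omega> 0\<bar> \<le> 1"
  using mono_End1_displacement_diff[of "cocycle \<sigma> G n \<omega>" x 0] cocycle_End1[of G \<omega> n]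
    cocycle_mono[of \<omega> n] End1 by simp

lemma cocycle_almost_additive:
  assumes "\<omega> \<in> space M"
  shows "\<bar>cocycle \<sigma> G (n + m) \<omega> 0 - cocycle \<sigma> G n \<omega> 0 - cocycle \<sigma> G m ((\<sigma> ^^ n) \<omega>) 0\<bar> \<le> 1"
  using cocycle_displacement_diff[OF sigma_space[OF assms], of m n "cocycle \<sigma> G n \<omega> 0"]
  by (simp add: cocycle_add)

text \<open>The Caratheodory argument: \<open>G\<close> is measurable in \<omega> and continuous in
  the point, so \<open>h\<close> may be replaced by its roundings to multiples of
  \<open>1 / k\<close>, which take countably many values.\<close>

lemma measurable_comp:
  assumes h: "h \<in> borel_measurable M"
  shows "(\<lambda>\<omega>. G ((\<sigma> ^^ n) \<omega>) (h \<omega>)) \<in> borel_measurable M"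
proof (rule borel_measurable_LIMSEQ_real)
  fix \<omega> assume w: "\<omega> \<in> space M"
  have "(\<lambda>k. real_of_int \<lfloor>real k * h \<omega>\<rfloor> / real k) \<longlonglongrightarrow> h \<omega>"
  proof (rule tendsto_sandwich[OF _ _ _ tendsto_const])
    have "(\<lambda>k. h \<omega> - 1 / real k) \<longlonglongrightarrow> h \<omega> - 0"
      by (intro tendsto_diff tendsto_const lim_const_over_n)
    then show "(\<lambda>k. h \<omega> - 1 / real k) \<longlonglongrightarrow> h \<omega>" by simp
    show "\<forall>\<^sub>F k in sequentially. h \<omega> - 1 / real k \<le> real_of_int \<lfloor>real k * h \<omega>\<rfloor> / real k"
      using eventually_gt_at_top[of 0]
    proof eventually_elim
      case (elim k)
      have "(real k * h \<omega> - 1) / real k \<le> real_of_int \<lfloor>real k * h \<omega>\<rfloor> / real k"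
        by (intro divide_right_mono) linarith+
      then show ?case using elim by (simp add: diff_divide_distrib)
    qed
    show "\<forall>\<^sub>F k in sequentially. real_of_int \<lfloor>real k * h \<omega>\<rfloor> / real k \<le> h \<omega>"
      using eventually_gt_at_top[of 0]
    proof eventually_elim
      case (elim k)
      have "real_of_int \<lfloor>real k * h \<omega>\<rfloor> \<le> real k * h \<omega>" by linarith
      then show ?case using elim by (simp add: field_simps)
    qed
  qed
  then show "(\<lambda>k. G ((\<sigma> ^^ n) \<omega>) (real_of_int \<lfloor>real k * h \<omega>\<rfloor> / real k)) \<longlonglongrightarrow> G ((\<sigma> ^^ n) \<omega>) (h \<omega>)"
    by (rule isCont_tendsto_compose[OF End1_real_isCont[OF End1[OF sigma_space[OF w]]]])
next
  fix k :: nat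
  have "(\<lambda>\<omega>. \<lfloor>real k * h \<omega>\<rfloor>) \<in> M \<rightarrow>\<^sub>M count_space UNIV"
    using h by measurable
  then show "(\<lambda>\<omega>. G ((\<sigma> ^^ n) \<omega>) (real_of_int \<lfloor>real k * h \<omega>\<rfloor> / real k)) \<in> borel_measurable M"
    by (rule measurable_compose_countable[rotated]) (rule measurable_compose[OF measurable_sigma_funpow measurable_at])
qed

lemma measurable_cocycle: "(\<lambda>\<omega>. cocycle \<sigma> G n \<omega> x) \<in> borel_measurable M"
proof (induction n)
  case (Suc n)
  then show ?case using measurable_comp[OF Suc] by simp
qed simp

lemma cocycle_displacement_le:
  "\<omega> \<in> space M \<Longrightarrow> \<bar>cocycle \<sigma> G n \<omega> x - x\<bar> \<le> (\<Sum>j<n. N ((\<sigma> ^^ j) \<omega>))"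
proof (induction n)
  case (Suc n)
  then show ?case
    using displacement_le[OF sigma_space[OF Suc.prems], of n "cocycle \<sigma> G n \<omega> x"] by simp
qed simp

lemma integrable_bound_sum: "integrable M (\<lambda>\<omega>. \<Sum>j<n. N ((\<sigma> ^^ j) \<omega>))"
  by (intro Bochner_Integration.integrable_sum integrable_sigma_funpow integrable_bound)

lemma integrable_cocycle: "integrable M (\<lambda>\<omega>. cocycle \<sigma> G n \<omega> 0)"
proof (rule Bochner_Integration.integrable_bound[OF integrable_bound_sum measurable_cocycle])
  show "AE \<omega> in M. norm (cocycle \<sigma> G n \<omega> 0) \<le> norm (\<Sum>j<n. N ((\<sigma> ^^ j) \<omega>))"
    using cocycle_displacement_le[of _ n 0] by (intro AE_I2) fastforce
qed

text \<open>The starting point changes the average by at most \<open>1 / n\<close>, so one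
  exceptional set of \<omega> serves all \<open>x\<close>.\<close>

lemma avg_displacement_tendsto:
  assumes w: "\<omega> \<in> space M" and lim: "(\<lambda>n. cocycle \<sigma> G n \<omega> 0 / n) \<longlonglongrightarrow> r"
  shows "(\<lambda>n. avg_displacement \<sigma> G n \<omega> x) \<longlonglongrightarrow> r"
proof (rule Lim_transform2[OF lim])
  show "(\<lambda>n. cocycle \<sigma> G n \<omega> 0 / n - avg_displacement \<sigma> G n \<omega> x) \<longlonglongrightarrow> 0"
  proof (rule Lim_null_comparison[OF always_eventually lim_const_over_n[of 1]], intro allI)
    fix n
    have "norm (cocycle \<sigma> G n \<omega> 0 / n - avg_displacement \<sigma> G n \<omega> x)
        = \<bar>(cocycle \<sigma> G n \<omega> x - x) - cocycle \<sigma> G n \<omega> 0\<bar> / n"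
      by (simp add: avg_displacement_def diff_divide_distrib[symmetric] abs_minus_commute)
    also have "\<dots> \<le> 1 / n"
      using cocycle_displacement_diff[OF w] by (intro divide_right_mono) auto
    finally show "norm (cocycle \<sigma> G n \<omega> 0 / n - avg_displacement \<sigma> G n \<omega> x) \<le> 1 / n" .
  qed
qed

text \<open>The almost sure limit \<open>r\<close>, as a constant function, shows that the choice in
  \<open>random_rotation_number\<close> succeeds. Uniqueness of limits identifies the chosen
  function with \<open>r\<close> almost everywhere, hence also its mean.\<close>

lemma
  shows AE_rotation_number:
      "AE \<omega> in M. (\<lambda>n. cocycle \<sigma> G n \<omega> 0 / n) \<longlonglongrightarrow> mean_rotation_number M \<sigma> G"
    and rotation_number_close:
      "k > 0 \<Longrightarrow> \<bar>mean_rotation_number M \<sigma> G - (\<integral>\<omega>. cocycle \<sigma> G k \<omega> 0 \<partial>M) / k\<bar> \<le> 1 / k"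
proof -
  obtain r where r: "\<And>k. k > 0 \<Longrightarrow> \<bar>r - (\<integral>\<omega>. cocycle \<sigma> G k \<omega> 0 \<partial>M) / k\<bar> \<le> 1 / k"
      "AE \<omega> in M. (\<lambda>n. cocycle \<sigma> G n \<omega> 0 / n) \<longlonglongrightarrow> r"
    using almost_additive_ergodic[of "\<lambda>n \<omega>. cocycle \<sigma> G n \<omega> 0" 1,
        OF integrable_cocycle cocycle_almost_additive] by blast
  have lim: "AE \<omega> in M. (\<lambda>n. avg_displacement \<sigma> G n \<omega> x) \<longlonglongrightarrow> r" for x
    using r(2) AE_space by eventually_elim (rule avg_displacement_tendsto)
  then have "is_random_rotation_number M \<sigma> G (\<lambda>_. r)"
    by (simp add: is_random_rotation_number_def)
  then have "is_random_rotation_number M \<sigma> G (random_rotation_number M \<sigma> G)"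
    unfolding random_rotation_number_def
    by (rule someI[where P="is_random_rotation_number M \<sigma> G"])
  then have "AE \<omega> in M. (\<lambda>n. avg_displacement \<sigma> G n \<omega> 0) \<longlonglongrightarrow> random_rotation_number M \<sigma> G \<omega>"
      and int: "integrable M (random_rotation_number M \<sigma> G)"
    by (auto simp: is_random_rotation_number_def)
  from this(1) lim have "AE \<omega> in M. random_rotation_number M \<sigma> G \<omega> = r"
    by eventually_elim (rule LIMSEQ_unique)
  then have "mean_rotation_number M \<sigma> G = (\<integral>\<omega>. r \<partial>M)"
    unfolding mean_rotation_number_def using int by (intro integral_cong_AE) auto
  then have "mean_rotation_number M \<sigma> G = r" by (simp add: prob_space)
  with r show "AE \<omega> in M. (\<lambda>n. cocycle \<sigma> G n \<omega> 0 / n) \<longlonglongrightarrow> mean_rotation_number M \<sigma> G"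
      "k > 0 \<Longrightarrow> \<bar>mean_rotation_number M \<sigma> G - (\<integral>\<omega>. cocycle \<sigma> G k \<omega> 0 \<partial>M) / k\<bar> \<le> 1 / k"
    by simp_all
qed

text \<open>Time \<open>n + 1\<close> from \<omega> is time \<open>n\<close> from
  \<open>\<sigma> \<omega>\<close> started at \<open>G \<omega> 0\<close> instead of 0, which costs
  at most \<open>1 + \<bar>G \<omega> 0\<bar>\<close>; the change of denominator is
  harmless.\<close>

lemma cocycle_shift_tendsto_iff:
  assumes w: "\<omega> \<in> space M"
  shows "(\<lambda>n. cocycle \<sigma> G n (\<sigma> \<omega>) 0 / n) \<longlonglongrightarrow> c \<longleftrightarrow> (\<lambda>n. cocycle \<sigma> G n \<omega> 0 / n) \<longlonglongrightarrow> c"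
proof -
  let ?a = "\<lambda>n. cocycle \<sigma> G n \<omega> 0" and ?b = "\<lambda>n. cocycle \<sigma> G n (\<sigma> \<omega>) 0"
  have "(\<lambda>n. ?a (Suc n) / real n - ?b n / real n) \<longlonglongrightarrow> 0"
  proof (rule Lim_null_comparison[OF always_eventually lim_const_over_n[of "1 + \<bar>G \<omega> 0\<bar>"]], intro allI)
    fix n
    have "?a (Suc n) = cocycle \<sigma> G n (\<sigma> \<omega>) (G \<omega> 0)"
      using cocycle_add[of \<sigma> G 1 n \<omega>] by simp
    then have "\<bar>?a (Suc n) - ?b n\<bar> \<le> 1 + \<bar>G \<omega> 0\<bar>"
      using cocycle_displacement_diff[OF sigma_space[OF w, of 1], of n "G \<omega> 0"]
      by (simp del: cocycle.simps)
    then have "\<bar>?a (Suc n) - ?b n\<bar> / n \<le> (1 + \<bar>G \<omega> 0\<bar>) / n"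
      by (intro divide_right_mono) auto
    then show "norm (?a (Suc n) / real n - ?b n / real n) \<le> (1 + \<bar>G \<omega> 0\<bar>) / n"
      by (simp add: diff_divide_distrib[symmetric] del: cocycle.simps)
  qed
  then have "(\<lambda>n. ?b n / n) \<longlonglongrightarrow> c \<longleftrightarrow> (\<lambda>n. ?a (Suc n) / real n) \<longlonglongrightarrow> c"
    by (rule Lim_transform_eq[symmetric])
  also have "\<dots> \<longleftrightarrow> (\<lambda>n. ?a (Suc n) / real (Suc n)) \<longlonglongrightarrow> c"
  proof
    assume "(\<lambda>n. ?a (Suc n) / real n) \<longlonglongrightarrow> c"
    then have "(\<lambda>n. ?a (Suc n) / real n * (real n / real (Suc n))) \<longlonglongrightarrow> c * 1"
      by (intro tendsto_mult LIMSEQ_n_over_Suc_n)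
    moreover have "\<forall>\<^sub>F n in sequentially. ?a (Suc n) / real n * (real n / real (Suc n)) = ?a (Suc n) / real (Suc n)"
      using eventually_gt_at_top[of 0] by eventually_elim (simp del: cocycle.simps of_nat_Suc)
    ultimately show "(\<lambda>n. ?a (Suc n) / real (Suc n)) \<longlonglongrightarrow> c"
      by (simp only: mult_1_right tendsto_cong)
  next
    assume "(\<lambda>n. ?a (Suc n) / real (Suc n)) \<longlonglongrightarrow> c"
    then have "(\<lambda>n. ?a (Suc n) / real (Suc n) * (real (Suc n) / real n)) \<longlonglongrightarrow> c * 1"
      by (intro tendsto_mult LIMSEQ_Suc_n_over_n)
    then show "(\<lambda>n. ?a (Suc n) / real n) \<longlonglongrightarrow> c"
      by (simp del: cocycle.simps of_nat_Suc)
  qed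
  also have "\<dots> \<longleftrightarrow> (\<lambda>n. ?a n / real n) \<longlonglongrightarrow> c"
    using filterlim_sequentially_Suc[of "\<lambda>n. ?a n / real n"] by simp
  finally show ?thesis .
qed

text \<open>At the common point the maps are compared first, then monotonicity of \<open>G\<close>
  moves the point. \<open>H\<close> is arbitrary, so the comparison applies to \<open>F\<close>
  itself.\<close>

lemma cocycle_le:
  assumes w: "\<omega> \<in> space M" and le: "\<And>\<omega> x. \<omega> \<in> space M \<Longrightarrow> H \<omega> x \<le> G \<omega> x"
  shows "cocycle \<sigma> H n \<omega> x \<le> cocycle \<sigma> G n \<omega> x"
proof (induction n)
  case (Suc n)
  have "H ((\<sigma> ^^ n) \<omega>) (cocycle \<sigma> H n \<omega> x) \<le> G ((\<sigma> ^^ n) \<omega>) (cocycle \<sigma> H n \<omega> x)"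
    by (rule le[OF sigma_space[OF w]])
  also have "\<dots> \<le> G ((\<sigma> ^^ n) \<omega>) (cocycle \<sigma> G n \<omega> x)"
    using monoD[OF mono[OF sigma_space[OF w]] Suc] .
  finally show ?case by simp
qed simp

lemma le_cocycle:
  assumes w: "\<omega> \<in> space M" and le: "\<And>\<omega> x. \<omega> \<in> space M \<Longrightarrow> G \<omega> x \<le> H \<omega> x"
  shows "cocycle \<sigma> G n \<omega> x \<le> cocycle \<sigma> H n \<omega> x"
proof (induction n)
  case (Suc n)
  have "G ((\<sigma> ^^ n) \<omega>) (cocycle \<sigma> G n \<omega> x) \<le> G ((\<sigma> ^^ n) \<omega>) (cocycle \<sigma> H n \<omega> x)"
    using monoD[OF mono[OF sigma_space[OF w]] Suc] .
  also have "\<dots> \<le> H ((\<sigma> ^^ n) \<omega>) (cocycle \<sigma> H n \<omega> x)"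
    by (rule le[OF sigma_space[OF w]])
  finally show ?case by simp
qed simp

end

section \<open>Measurability of the envelopes and comparison of rotation numbers\<close>

lemma borel_measurable_upper_map:
  assumes F: "\<And>\<omega>. \<omega> \<in> space M \<Longrightarrow> F \<omega> \<in> End1_real"
    and meas: "\<And>x. (\<lambda>\<omega>. F \<omega> x) \<in> borel_measurable M"
  shows "(\<lambda>\<omega>. upper_map F \<omega> x) \<in> borel_measurable M"
  unfolding borel_measurable_iff_le
proof
  fix c
  \<comment> \<open>Nonnegative rational offsets from \<open>x\<close> are dense in the ray and
    never leave it: a point \<open>y\<close> with \<open>F \<omega> y > c\<close> is approximated
    from its left.\<close>
  have "upper_map F \<omega> x \<le> c \<longleftrightarrow> (\<forall>q::rat. 0 \<le> q \<longrightarrow> F \<omega> (x - of_rat q) \<le> c)"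
    if w: "\<omega> \<in> space M" for \<omega>
  proof
    assume *: "\<forall>q::rat. 0 \<le> q \<longrightarrow> F \<omega> (x - of_rat q) \<le> c"
    show "upper_map F \<omega> x \<le> c"
      unfolding upper_map_le_iff[of F \<omega>, OF F[OF w]]
    proof (intro allI impI leI notI)
      fix y assume y: "y \<le> x" "c < F \<omega> y"
      have "\<forall>\<^sub>F z in at y. c < F \<omega> z"
        using End1_real_isCont[OF F[OF w], of y] y(2) unfolding isCont_def by (rule order_tendstoD)
      then obtain d where d: "d > 0" "\<And>z. z \<noteq> y \<Longrightarrow> dist z y < d \<Longrightarrow> c < F \<omega> z"
        unfolding eventually_at by auto
      obtain q where q: "x - y < of_rat q" "of_rat q < x - y + d"
        using of_rat_dense[of "x - y" "x - y + d"] d(1) by auto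
      have "0 \<le> (of_rat q :: real)" using q(1) y(1) by linarith
      then have "F \<omega> (x - of_rat q) \<le> c" using * by simp
      moreover have "c < F \<omega> (x - of_rat q)" using q by (intro d(2)) (auto simp: dist_real_def)
      ultimately show False by simp
    qed
  qed (simp add: upper_map_le_iff[of F \<omega>, OF F[OF w]])
  then have "{\<omega> \<in> space M. upper_map F \<omega> x \<le> c}
      = {\<omega> \<in> space M. \<forall>q::rat. 0 \<le> q \<longrightarrow> F \<omega> (x - of_rat q) \<le> c}"
    by blast
  also have "\<dots> \<in> sets M" using meas by measurable
  finally show "{\<omega> \<in> space M. upper_map F \<omega> x \<le> c} \<in> sets M" .
qed

lemma borel_measurable_lower_map:
  assumes F: "\<And>\<omega>. \<omega> \<in> space M \<Longrightarrow> F \<omega> \<in> End1_real"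
    and meas: "\<And>x. (\<lambda>\<omega>. F \<omega> x) \<in> borel_measurable M"
  shows "(\<lambda>\<omega>. lower_map F \<omega> x) \<in> borel_measurable M"
  unfolding lower_map_eq_upper_map
  using F meas by (intro borel_measurable_uminus borel_measurable_upper_map reflect_End1) auto

lemma (in random_monotone) mean_rotation_number_le:
  assumes "random_monotone M \<sigma> H K"
    and le: "\<And>\<omega> x. \<omega> \<in> space M \<Longrightarrow> G \<omega> x \<le> H \<omega> x"
  shows "mean_rotation_number M \<sigma> G \<le> mean_rotation_number M \<sigma> H"
proof -
  interpret H: random_monotone M \<sigma> H K by fact
  \<comment> \<open>The statement does not involve \<omega>, so holding almost everywhere in a
    probability space means holding.\<close>
  have "AE \<omega> in M. mean_rotation_number M \<sigma> G \<le> mean_rotation_number M \<sigma> H"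
    using AE_rotation_number H.AE_rotation_number AE_space
  proof eventually_elim
    case (elim \<omega>)
    have "cocycle \<sigma> G n \<omega> 0 / n \<le> cocycle \<sigma> H n \<omega> 0 / n" for n
      using le_cocycle[OF elim(3) le] by (intro divide_right_mono) auto
    then show ?case using LIMSEQ_le[OF elim(1,2)] by blast
  qed
  then show ?thesis by simp
qed

section \<open>Rotation sets\<close>

text \<open>Compactness: prescribing the orbit backwards from time \<open>n\<close> gives points at which the two
  cocycles agree up to time \<open>n\<close>.\<close>

lemma (in ergodic_pmps) common_orbit:
  assumes F: "\<And>\<omega>. \<omega> \<in> space M \<Longrightarrow> F \<omega> \<in> End1_real"
    and W: "\<And>\<omega>. \<omega> \<in> space M \<Longrightarrow> W \<omega> \<in> End1_real"
    and surj: "\<And>\<omega> v. \<omega> \<in> space M \<Longrightarrow> \<exists>x. W \<omega> x = v \<and> F \<omega> x = v"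
    and w: "\<omega> \<in> space M"
  shows "\<exists>x\<in>{0..1}. \<forall>n. cocycle \<sigma> F n \<omega> x = cocycle \<sigma> W n \<omega> x"
proof -
  let ?F = "\<lambda>n. cocycle \<sigma> F n \<omega>" and ?W = "\<lambda>n. cocycle \<sigma> W n \<omega>"
  have cF: "?F n \<in> End1_real" and cW: "?W n \<in> End1_real" for n
    using cocycle_End1[of F] cocycle_End1[of W] F W w by blast+
  define K where "K n = {x \<in> {0..1}. \<forall>i\<in>{..n}. ?F i x = ?W i x}" for n
  \<comment> \<open>The arbitrary endpoint \<open>v\<close> carries the induction: the last map
    dictates a value \<open>u\<close> at time \<open>n\<close>, and the hypothesis must supply an
    orbit ending there.\<close>
  have hit: "\<exists>x. (\<forall>i\<le>n. ?F i x = ?W i x) \<and> ?W n x = v" for n v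
  proof (induction n arbitrary: v)
    case (Suc n)
    obtain u where u: "W ((\<sigma> ^^ n) \<omega>) u = v" "F ((\<sigma> ^^ n) \<omega>) u = v"
      using surj[OF sigma_space[OF w]] by blast
    obtain x where "\<forall>i\<le>n. ?F i x = ?W i x" "?W n x = u" using Suc by blast
    then show ?case using u by (intro exI[of _ x]) (auto simp: le_Suc_eq)
  qed simp
  have "(\<Inter>n. K n) \<noteq> {}"
  proof (rule compact_nest)
    show "compact (K n)" for n
    proof -
      have "closed (\<Inter>i\<in>{..n}. {x. ?F i x = ?W i x})"
        by (intro closed_INT ballI closed_Collect_eq End1_real_continuous cF cW)
      moreover have "K n = {0..1} \<inter> (\<Inter>i\<in>{..n}. {x. ?F i x = ?W i x})"
        by (auto simp: K_def)
      ultimately show ?thesis by (simp add: compact_Int_closed)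
    qed
    show "K n \<noteq> {}" for n
    proof -
      obtain x where x: "\<forall>i\<le>n. ?F i x = ?W i x" using hit by blast
      \<comment> \<open>Both cocycles commute with integer translations, so the agreement can be
        moved into the unit interval.\<close>
      have "?F i (frac x) = ?W i (frac x)" if "i \<le> n" for i
        using x that End1_real_add_of_int[OF cF, of i x "- \<lfloor>x\<rfloor>"]
          End1_real_add_of_int[OF cW, of i x "- \<lfloor>x\<rfloor>"] by (simp add: frac_def)
      moreover have "frac x \<in> {0..1}" using frac_ge_0[of x] frac_lt_1[of x] by simp
      ultimately have "frac x \<in> K n" by (auto simp: K_def)
      then show ?thesis by blast
    qed
    show "K n \<subseteq> K m" if "m \<le> n" for m n
      using that by (auto simp: K_def)
  qed
  then obtain x where "\<And>n. x \<in> K n" by blast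
  then show ?thesis unfolding K_def by blast
qed

section \<open>The one-parameter family \<open>W t\<close> and its rotation number\<close>

locale random_endo = ergodic_pmps M \<sigma> for M :: "'w measure" and \<sigma> +
  fixes F :: "'w \<Rightarrow> real \<Rightarrow> real"
  assumes F: "F \<in> integrable_End1 M"
begin

abbreviation bound :: "'w \<Rightarrow> real" where
  "bound \<omega> \<equiv> norm (displacement (F \<omega>))"

text \<open>Cutting \<open>t\<close> at 0 keeps levels nonnegative while the parameter runs over the
  whole line, so that \<open>rho\<close> has two-sided continuity at 0 too. At \<open>t = 1\<close>
  the level reaches the height needed for the upper map.\<close>

definition level :: "real \<Rightarrow> 'w \<Rightarrow> real" where
  "level t \<omega> = max 0 t * (2 * bound \<omega>)"

abbreviation W :: "real \<Rightarrow> 'w \<Rightarrow> real \<Rightarrow> real" where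
  "W t \<equiv> water_map F (level t)"

lemma level_nonneg: "0 \<le> level t \<omega>"
  by (simp add: level_def)

lemma level_mono: "s \<le> t \<Longrightarrow> level s \<omega> \<le> level t \<omega>"
  unfolding level_def by (intro mult_right_mono) auto

lemma integrable_bound: "integrable M bound"
  using F by (simp add: integrable_End1_def)

lemma F_End1: "\<omega> \<in> space M \<Longrightarrow> F \<omega> \<in> End1_real"
  using F measurable_space[of F M borel_End1_real \<omega>]
  by (simp add: integrable_End1_def borel_End1_real_def)

lemma F_displacement: "\<omega> \<in> space M \<Longrightarrow> \<bar>F \<omega> x - x\<bar> \<le> bound \<omega>"
  using abs_diff_le_norm_displacement F_End1 by blast

text \<open>Evaluation at \<open>x\<close> is 1-Lipschitz for the sup norm, hence Borel.\<close>

lemma measurable_F: "(\<lambda>\<omega>. F \<omega> x) \<in> borel_measurable M"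
proof -
  have "F \<in> M \<rightarrow>\<^sub>M borel_End1_real" using F by (simp add: integrable_End1_def)
  moreover have "displacement \<in> borel_End1_real \<rightarrow>\<^sub>M borel"
    unfolding borel_End1_real_def by (rule measurable_vimage_algebra1) auto
  moreover have "(\<lambda>d :: real \<Rightarrow>\<^sub>C real. apply_bcontfun d x) \<in> borel_measurable borel"
  proof (intro borel_measurable_continuous_onI continuous_onI)
    fix d :: "real \<Rightarrow>\<^sub>C real" and e :: real assume e: "e > 0"
    have "dist (apply_bcontfun d' x) (apply_bcontfun d x) \<le> e" if "dist d' d < e" for d'
      using dist_bounded[of d' x d] that by linarith
    with e show "\<exists>\<delta>>0. \<forall>d'\<in>UNIV. dist d' d < \<delta> \<longrightarrow> dist (apply_bcontfun d' x) (apply_bcontfun d x) \<le> e"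
      by blast
  qed
  ultimately have "(\<lambda>\<omega>. apply_bcontfun (displacement (F \<omega>)) x) \<in> borel_measurable M"
    by (auto intro: measurable_compose)
  then have "(\<lambda>\<omega>. apply_bcontfun (displacement (F \<omega>)) x + x) \<in> borel_measurable M"
    by simp
  also have "?this \<longleftrightarrow> ?thesis"
    by (intro measurable_cong) (simp add: apply_displacement F_End1)
  finally show ?thesis .
qed

lemma random_monotone_water: "random_monotone M \<sigma> (W t) bound"
proof
  fix \<omega> x assume w: "\<omega> \<in> space M"
  show "W t \<omega> \<in> End1_real" by (rule water_map_End1[of F \<omega>, OF F_End1[OF w]])
  show "mono (W t \<omega>)" by (rule mono_water_map[of F \<omega>, OF F_End1[OF w]])
  show "\<bar>W t \<omega> x - x\<bar> \<le> bound \<omega>"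
    by (rule water_map_displacement[of F \<omega>, OF F_End1[OF w] F_displacement[OF w] level_nonneg])
next
  fix x
  have "(\<lambda>\<omega>. truncated_map F (level t) \<omega> x) \<in> borel_measurable M" for x
    unfolding truncated_map_def level_def
    using measurable_F borel_measurable_lower_map[OF F_End1 measurable_F] integrable_bound
    by (intro borel_measurable_min borel_measurable_add borel_measurable_times
        borel_measurable_const) auto
  then show "(\<lambda>\<omega>. W t \<omega> x) \<in> borel_measurable M"
    unfolding water_map_def
    by (intro borel_measurable_upper_map truncated_map_End1 F_End1)
qed (rule integrable_bound)

sublocale W: random_monotone M \<sigma> "W t" bound for t
  by (rule random_monotone_water)

lemma random_monotone_lower: "random_monotone M \<sigma> (lower_map F) bound"
proof
  fix \<omega> x assume w: "\<omega> \<in> space M"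
  show "lower_map F \<omega> \<in> End1_real" by (rule lower_map_End1[of F \<omega>, OF F_End1[OF w]])
  show "mono (lower_map F \<omega>)" by (rule mono_lower_map[of F \<omega>, OF F_End1[OF w]])
  show "\<bar>lower_map F \<omega> x - x\<bar> \<le> bound \<omega>"
    using W.displacement_le[OF w, of 0 x] water_map_zero[of F \<omega> "level 0" x, OF F_End1[OF w]]
    by (simp add: level_def)
qed (rule borel_measurable_lower_map integrable_bound F_End1 measurable_F; assumption?)+

lemma random_monotone_upper: "random_monotone M \<sigma> (upper_map F) bound"
proof
  fix \<omega> x assume w: "\<omega> \<in> space M"
  show "upper_map F \<omega> \<in> End1_real" by (rule upper_map_End1[of F \<omega>, OF F_End1[OF w]])
  show "mono (upper_map F \<omega>)" by (rule mono_upper_map[of F \<omega>, OF F_End1[OF w]])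
  show "\<bar>upper_map F \<omega> x - x\<bar> \<le> bound \<omega>"
    using W.displacement_le[OF w, of 1 x]
      water_map_full[of F \<omega> "bound \<omega>" "level 1" x, OF F_End1[OF w] F_displacement[OF w]]
    by (simp add: level_def)
qed (rule borel_measurable_upper_map integrable_bound F_End1 measurable_F; assumption?)+

definition rho :: "real \<Rightarrow> real" where
  "rho t = mean_rotation_number M \<sigma> (W t)"

lemma W_zero: "\<omega> \<in> space M \<Longrightarrow> W 0 \<omega> x = lower_map F \<omega> x"
  by (rule water_map_zero) (simp_all add: F_End1 level_def)

lemma W_one: "\<omega> \<in> space M \<Longrightarrow> W 1 \<omega> x = upper_map F \<omega> x"
  by (rule water_map_full[OF F_End1 F_displacement]) (simp_all add: level_def)

text \<open>\<open>W 0\<close> and \<open>lower_map F\<close> are known to agree only over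
  \<open>space M\<close>, so the two means are compared by inequalities in both directions.\<close>

lemma rho_zero: "rho 0 = mean_rotation_number M \<sigma> (lower_map F)"
  using W.mean_rotation_number_le[OF random_monotone_lower, of 0]
    random_monotone.mean_rotation_number_le[OF random_monotone_lower random_monotone_water[of 0]] W_zero
  by (simp add: rho_def antisym)

lemma rho_one: "rho 1 = mean_rotation_number M \<sigma> (upper_map F)"
  using W.mean_rotation_number_le[OF random_monotone_upper, of 1]
    random_monotone.mean_rotation_number_le[OF random_monotone_upper random_monotone_water[of 1]] W_one
  by (simp add: rho_def antisym)

lemma W_mono:
  assumes "\<omega> \<in> space M" "s \<le> t"
  shows "W s \<omega> x \<le> W t \<omega> x"
  by (rule water_map_mono_level(1)) (use assms F_End1 level_mono in auto)

text \<open>Moving level and point together is needed because, in the cocycle, the point itself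
  depends on the level. The Lipschitz bound in the level is uniform in the point.\<close>

lemma tendsto_W:
  assumes w: "\<omega> \<in> space M" and t: "t \<longlonglongrightarrow> s" and x: "x \<longlonglongrightarrow> y"
  shows "(\<lambda>n. W (t n) \<omega> (x n)) \<longlonglongrightarrow> W s \<omega> y"
proof (rule Lim_transform)
  show "(\<lambda>n. W s \<omega> (x n)) \<longlonglongrightarrow> W s \<omega> y"
    using isCont_tendsto_compose[OF End1_real_isCont[OF W.End1[OF w]] x] .
  have le: "\<bar>W u \<omega> z - W v \<omega> z\<bar> \<le> \<bar>level u \<omega> - level v \<omega>\<bar>" for u v z
    using water_map_mono_level[of F \<omega> "level u" "level v" z, OF F_End1[OF w]]
      water_map_mono_level[of F \<omega> "level v" "level u" z, OF F_End1[OF w]]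
    by linarith
  show "(\<lambda>n. W (t n) \<omega> (x n) - W s \<omega> (x n)) \<longlonglongrightarrow> 0"
  proof (rule Lim_null_comparison[OF always_eventually], intro allI)
    show "norm (W (t n) \<omega> (x n) - W s \<omega> (x n)) \<le> \<bar>level (t n) \<omega> - level s \<omega>\<bar>" for n
      using le by simp
    have "(\<lambda>n. \<bar>level (t n) \<omega> - level s \<omega>\<bar>) \<longlonglongrightarrow> \<bar>level s \<omega> - level s \<omega>\<bar>"
      unfolding level_def
      by (intro tendsto_rabs tendsto_diff tendsto_mult tendsto_max tendsto_const t)
    then show "(\<lambda>n. \<bar>level (t n) \<omega> - level s \<omega>\<bar>) \<longlonglongrightarrow> 0" by simp
  qed
qed

lemma tendsto_cocycle_W:
  assumes w: "\<omega> \<in> space M" and t: "t \<longlonglongrightarrow> s"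
  shows "(\<lambda>n. cocycle \<sigma> (W (t n)) k \<omega> x) \<longlonglongrightarrow> cocycle \<sigma> (W s) k \<omega> x"
proof (induction k)
  case (Suc k)
  then show ?case using tendsto_W[OF sigma_space[OF w] t] by simp
qed simp

text \<open>Up to \<open>1 / k\<close>, uniformly in the parameter, \<open>rho\<close> is the mean
  displacement at time \<open>k\<close> divided by \<open>k\<close>, which is continuous by
  dominated convergence.\<close>

lemma isCont_rho: "isCont rho s"
proof (rule continuous_at_sequentiallyI)
  fix t :: "nat \<Rightarrow> real" assume t: "t \<longlonglongrightarrow> s"
  let ?I = "\<lambda>k u. \<integral>\<omega>. cocycle \<sigma> (W u) k \<omega> 0 \<partial>M"
  have I: "(\<lambda>n. ?I k (t n)) \<longlonglongrightarrow> ?I k s" for k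
  proof (rule integral_dominated_convergence)
    show "(\<lambda>\<omega>. cocycle \<sigma> (W s) k \<omega> 0) \<in> borel_measurable M"
      and "\<And>n. (\<lambda>\<omega>. cocycle \<sigma> (W (t n)) k \<omega> 0) \<in> borel_measurable M"
      by (rule W.measurable_cocycle)+
    show "integrable M (\<lambda>\<omega>. \<Sum>j<k. bound ((\<sigma> ^^ j) \<omega>))" by (rule W.integrable_bound_sum)
    show "AE \<omega> in M. (\<lambda>n. cocycle \<sigma> (W (t n)) k \<omega> 0) \<longlonglongrightarrow> cocycle \<sigma> (W s) k \<omega> 0"
      using tendsto_cocycle_W t by (intro AE_I2) auto
    show "AE \<omega> in M. norm (cocycle \<sigma> (W (t n)) k \<omega> 0) \<le> (\<Sum>j<k. bound ((\<sigma> ^^ j) \<omega>))" for n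
      using W.cocycle_displacement_le[of _ "t n" k 0] by (intro AE_I2) simp
  qed
  show "(\<lambda>n. rho (t n)) \<longlonglongrightarrow> rho s"
  proof (rule metric_LIMSEQ_I)
    fix e :: real assume e: "e > 0"
    obtain k :: nat where k: "k > 0" "1 / real k < e / 3"
    proof -
      obtain m where "inverse (real (Suc m)) < e / 3"
        using reals_Archimedean[of "e / 3"] e by auto
      then show thesis using that[of "Suc m"] by (simp add: inverse_eq_divide)
    qed
    have "(\<lambda>n. ?I k (t n) / k) \<longlonglongrightarrow> ?I k s / k" (is "?X \<longlonglongrightarrow> ?x")
      using k by (intro tendsto_divide I tendsto_const) auto
    then have "\<exists>m. \<forall>n\<ge>m. dist (?X n) ?x < e / 3"
      by (rule metric_LIMSEQ_D) (use e in simp)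
    then obtain m where m: "\<And>n. n \<ge> m \<Longrightarrow> dist (?X n) ?x < e / 3" by blast
    have "dist (rho (t n)) (rho s) < e" if "n \<ge> m" for n
      using m[OF that] W.rotation_number_close[OF k(1), of "t n"]
        W.rotation_number_close[OF k(1), of s] k(2)
      unfolding rho_def dist_real_def by linarith
    then show "\<exists>no. \<forall>n\<ge>no. dist (rho (t n)) (rho s) < e" by blast
  qed
qed

end

section \<open>The invariant set of full measure and the rotation sets on it\<close>

context random_endo
begin

text \<open>Rational levels suffice by monotonicity in the level and continuity of \<open>rho\<close>; with countably
  many conditions the set is measurable and of full measure.\<close>

definition good_set :: "'w set" where
  "good_set = {\<omega>\<in>space M. \<forall>q::rat.
     (\<lambda>n. cocycle \<sigma> (W (of_rat q)) n \<omega> 0 / n) \<longlonglongrightarrow> rho (of_rat q)}"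

lemma measurable_good_set: "good_set \<in> sets M"
proof -
  have "{\<omega>\<in>space M. (\<lambda>n. cocycle \<sigma> (W t) n \<omega> 0 / n) \<longlonglongrightarrow> rho t} \<in> sets M" for t
  proof -
    have "(\<lambda>n. cocycle \<sigma> (W t) n \<omega> 0 / n) \<longlonglongrightarrow> rho t \<longleftrightarrow>
        (\<forall>k. \<exists>m. \<forall>n\<ge>m. \<bar>cocycle \<sigma> (W t) n \<omega> 0 / n - rho t\<bar> < inverse (real (Suc k)))"
      (is "?L \<longleftrightarrow> ?R") for \<omega>
    proof
      assume ?R
      show ?L
      proof (rule metric_LIMSEQ_I)
        fix e :: real assume "e > 0"
        then obtain k where "inverse (real (Suc k)) < e" using reals_Archimedean by blast
        moreover obtain m where
            "\<And>n. n \<ge> m \<Longrightarrow> \<bar>cocycle \<sigma> (W t) n \<omega> 0 / n - rho t\<bar> < inverse (real (Suc k))"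
          using \<open>?R\<close> by blast
        ultimately have "dist (cocycle \<sigma> (W t) n \<omega> 0 / n) (rho t) < e" if "n \<ge> m" for n
          unfolding dist_real_def by (rule less_trans[rotated]) (use that in blast)
        then show "\<exists>m. \<forall>n\<ge>m. dist (cocycle \<sigma> (W t) n \<omega> 0 / n) (rho t) < e" by blast
      qed
    next
      assume ?L
      show ?R
      proof
        fix k
        have "0 < inverse (real (Suc k))" by simp
        from metric_LIMSEQ_D[OF \<open>?L\<close> this]
        show "\<exists>m. \<forall>n\<ge>m. \<bar>cocycle \<sigma> (W t) n \<omega> 0 / n - rho t\<bar> < inverse (real (Suc k))"
          unfolding dist_real_def .
      qed
    qed
    moreover have "{\<omega>\<in>space M. \<forall>k. \<exists>m. \<forall>n\<ge>m.
        \<bar>cocycle \<sigma> (W t) n \<omega> 0 / n - rho t\<bar> < inverse (real (Suc k))} \<in> sets M"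
    proof -
      have [measurable]: "(\<lambda>\<omega>. cocycle \<sigma> (W t) n \<omega> 0) \<in> borel_measurable M" for n
        by (rule W.measurable_cocycle)
      show ?thesis by measurable
    qed
    ultimately show ?thesis by (simp only:)
  qed
  then have "{\<omega>\<in>space M. \<forall>q::rat.
     (\<lambda>n. cocycle \<sigma> (W (of_rat q)) n \<omega> 0 / n) \<longlonglongrightarrow> rho (of_rat q)} \<in> sets M"
    by (rule sets.sets_Collect_countable_All)
  then show ?thesis by (simp only: good_set_def)
qed

lemma prob_good_set: "prob good_set = 1"
proof -
  have "AE \<omega> in M. \<forall>q::rat. (\<lambda>n. cocycle \<sigma> (W (of_rat q)) n \<omega> 0 / n) \<longlonglongrightarrow> rho (of_rat q)"
    unfolding AE_all_countable rho_def using W.AE_rotation_number by blast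
  then have "AE \<omega> in M. \<omega> \<in> good_set"
    using AE_space by eventually_elim (simp add: good_set_def)
  then show ?thesis using prob_Collect_eq_1[of "\<lambda>\<omega>. \<omega> \<in> good_set"] measurable_good_set
      sets.sets_into_space[OF measurable_good_set]
    by (simp add: AE_in_set_eq_1)
qed

text \<open>Invariance is exact, not just up to null sets, since
  \<open>cocycle_shift_tendsto_iff\<close> holds at every point of the space.\<close>

lemma good_set_invariant: "\<sigma> -` good_set \<inter> space M = good_set"
  using W.cocycle_shift_tendsto_iff sigma_space[of _ 1] by (auto simp: good_set_def)

text \<open>The level that realises a given rotation number need not be rational; this makes every
  level available on the same set.\<close>

lemma good_set_tendsto_rho:
  assumes w: "\<omega> \<in> good_set"
  shows "(\<lambda>n. cocycle \<sigma> (W t) n \<omega> 0 / n) \<longlonglongrightarrow> rho t"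
proof (rule order_tendstoI)
  have sp: "\<omega> \<in> space M"
    and lim: "\<And>q::rat. (\<lambda>n. cocycle \<sigma> (W (of_rat q)) n \<omega> 0 / n) \<longlonglongrightarrow> rho (of_rat q)"
    using w by (auto simp: good_set_def)
  have mono: "cocycle \<sigma> (W u) n \<omega> 0 / n \<le> cocycle \<sigma> (W v) n \<omega> 0 / n" if "u \<le> v" for u v n
    using W.le_cocycle[OF sp W_mono[OF _ that]] by (intro divide_right_mono) auto
  {
    fix c assume "c < rho t"
    then have "\<forall>\<^sub>F u in at t. c < rho u"
      using isCont_rho[of t] unfolding isCont_def by (intro order_tendstoD)
    then obtain d where d: "d > 0" "\<And>u. u \<noteq> t \<Longrightarrow> dist u t < d \<Longrightarrow> c < rho u"
      unfolding eventually_at by auto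
    obtain q where q: "t - d < of_rat q" "of_rat q < t"
      using of_rat_dense[of "t - d" t] d(1) by auto
    then have "c < rho (of_rat q)" by (intro d(2)) (auto simp: dist_real_def)
    then have "\<forall>\<^sub>F n in sequentially. c < cocycle \<sigma> (W (of_rat q)) n \<omega> 0 / n"
      by (rule order_tendstoD[OF lim])
    then show "\<forall>\<^sub>F n in sequentially. c < cocycle \<sigma> (W t) n \<omega> 0 / n"
      by eventually_elim (use mono[of "of_rat q" t] q in \<open>auto intro: less_le_trans\<close>)
  next
    fix c assume "rho t < c"
    then have "\<forall>\<^sub>F u in at t. rho u < c"
      using isCont_rho[of t] unfolding isCont_def by (intro order_tendstoD)
    then obtain d where d: "d > 0" "\<And>u. u \<noteq> t \<Longrightarrow> dist u t < d \<Longrightarrow> rho u < c"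
      unfolding eventually_at by auto
    obtain q where q: "t < of_rat q" "of_rat q < t + d"
      using of_rat_dense[of t "t + d"] d(1) by auto
    then have "rho (of_rat q) < c" by (intro d(2)) (auto simp: dist_real_def)
    then have "\<forall>\<^sub>F n in sequentially. cocycle \<sigma> (W (of_rat q)) n \<omega> 0 / n < c"
      by (rule order_tendstoD[OF lim])
    then show "\<forall>\<^sub>F n in sequentially. cocycle \<sigma> (W t) n \<omega> 0 / n < c"
      by eventually_elim (use mono[of t "of_rat q"] q in \<open>auto intro: le_less_trans\<close>)
  }
qed

lemma exists_rotation_point:
  assumes w: "\<omega> \<in> good_set" and c: "c \<in> {rho 0..rho 1}"
  shows "\<exists>x\<in>{0..1}. (\<lambda>n. avg_displacement \<sigma> F n \<omega> x) \<longlonglongrightarrow> c"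
proof -
  have sp: "\<omega> \<in> space M" using w by (auto simp: good_set_def)
  obtain t where t: "rho t = c"
    using IVT[of rho 0 c 1] c isCont_rho by (metis atLeastAtMost_iff zero_le_one)
  obtain x where x: "x \<in> {0..1}" "\<And>n. cocycle \<sigma> F n \<omega> x = cocycle \<sigma> (W t) n \<omega> x"
    using common_orbit[of F "W t" \<omega>, OF F_End1 W.End1 _ sp]
      water_map_eq_surj[of F _ "level t", OF F_End1 level_nonneg] by blast
  have "(\<lambda>n. avg_displacement \<sigma> (W t) n \<omega> x) \<longlonglongrightarrow> c"
    unfolding t[symmetric] by (rule W.avg_displacement_tendsto[OF sp good_set_tendsto_rho[OF w]])
  then have "(\<lambda>n. avg_displacement \<sigma> F n \<omega> x) \<longlonglongrightarrow> c"
    unfolding avg_displacement_def x(2) .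
  then show ?thesis using x(1) by blast
qed

text \<open>The bounds do not depend on \<open>y\<close>, which is what \<open>Rot_sub\<close> with
  its varying starting points requires. The correction \<open>1 / n\<close> pays for moving the
  starting point to 0.\<close>

lemma avg_displacement_bounds:
  assumes w: "\<omega> \<in> good_set"
  obtains l u where "l \<longlonglongrightarrow> rho 0" "u \<longlonglongrightarrow> rho 1"
    "\<And>n y. l n \<le> avg_displacement \<sigma> F n \<omega> y" "\<And>n y. avg_displacement \<sigma> F n \<omega> y \<le> u n"
proof
  have sp: "\<omega> \<in> space M" using w by (auto simp: good_set_def)
  let ?l = "\<lambda>n. cocycle \<sigma> (W 0) n \<omega> 0 / n - 1 / n" and ?u = "\<lambda>n. cocycle \<sigma> (W 1) n \<omega> 0 / n + 1 / n"
  show "?l \<longlonglongrightarrow> rho 0"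
    using tendsto_diff[OF good_set_tendsto_rho[OF w, of 0] lim_const_over_n[of 1]] by simp
  show "?u \<longlonglongrightarrow> rho 1"
    using tendsto_add[OF good_set_tendsto_rho[OF w, of 1] lim_const_over_n[of 1]] by simp
  fix n y
  have "cocycle \<sigma> (W 0) n \<omega> y \<le> cocycle \<sigma> F n \<omega> y"
    by (rule W.le_cocycle[OF sp]) (simp add: W_zero lower_map_le F_End1)
  moreover have "\<bar>(cocycle \<sigma> (W 0) n \<omega> y - y) - cocycle \<sigma> (W 0) n \<omega> 0\<bar> \<le> 1"
    by (rule W.cocycle_displacement_diff[OF sp])
  ultimately have "(cocycle \<sigma> (W 0) n \<omega> 0 - 1) / n \<le> (cocycle \<sigma> F n \<omega> y - y) / n"
    by (intro divide_right_mono) linarith+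
  then show "?l n \<le> avg_displacement \<sigma> F n \<omega> y"
    by (simp add: avg_displacement_def diff_divide_distrib)
  have "cocycle \<sigma> F n \<omega> y \<le> cocycle \<sigma> (W 1) n \<omega> y"
    by (rule W.cocycle_le[OF sp]) (simp add: W_one le_upper_map F_End1)
  moreover have "\<bar>(cocycle \<sigma> (W 1) n \<omega> y - y) - cocycle \<sigma> (W 1) n \<omega> 0\<bar> \<le> 1"
    by (rule W.cocycle_displacement_diff[OF sp])
  ultimately have "(cocycle \<sigma> F n \<omega> y - y) / n \<le> (cocycle \<sigma> (W 1) n \<omega> 0 + 1) / n"
    by (intro divide_right_mono) linarith+
  then show "avg_displacement \<sigma> F n \<omega> y \<le> ?u n"
    by (simp add: avg_displacement_def add_divide_distrib)
qed

text \<open>The interval lies in \<open>Rot_ord\<close>, this in \<open>Rot_sub\<close>, and this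
  again in the interval by the uniform bounds. For upper and lower limits the same bounds give one
  inclusion and the points with a true limit the other.\<close>

theorem rotation_sets:
  assumes w: "\<omega> \<in> good_set"
  shows "Rot_ord \<sigma> F \<omega> = {rho 0..rho 1}" (is ?ord)
    and "Rot_sub \<sigma> F \<omega> = {rho 0..rho 1}" (is ?sub)
    and "Rot_plus \<sigma> F \<omega> = ereal ` {rho 0..rho 1}" (is ?plus)
    and "Rot_minus \<sigma> F \<omega> = ereal ` {rho 0..rho 1}" (is ?minus)
    and "Rot \<sigma> F \<omega> = {rho 0..rho 1}" (is ?rot)
proof -
  let ?I = "{rho 0..rho 1}" and ?A = "\<lambda>x n. avg_displacement \<sigma> F n \<omega> x"
  obtain l u where lu: "l \<longlonglongrightarrow> rho 0" "u \<longlonglongrightarrow> rho 1"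
      "\<And>n y. l n \<le> ?A y n" "\<And>n y. ?A y n \<le> u n"
    using avg_displacement_bounds[OF w] by metis
  have pt: "\<exists>x. ?A x \<longlonglongrightarrow> c" if "c \<in> ?I" for c
    using exists_rotation_point[OF w that] by blast
  have sub: "Rot_sub \<sigma> F \<omega> \<subseteq> ?I"
  proof
    fix c assume "c \<in> Rot_sub \<sigma> F \<omega>"
    then obtain n :: "nat \<Rightarrow> nat" and y :: "nat \<Rightarrow> real"
      where n: "filterlim n at_top sequentially" and lim: "(\<lambda>k. ?A (y k) (n k)) \<longlonglongrightarrow> c"
      by (auto simp: Rot_sub_def)
    have "rho 0 \<le> c" "c \<le> rho 1"
      using LIMSEQ_le[OF filterlim_compose[OF lu(1) n] lim] LIMSEQ_le[OF lim filterlim_compose[OF lu(2) n]]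
        lu(3,4) by blast+
    then show "c \<in> ?I" by simp
  qed
  have ord_sub: "Rot_ord \<sigma> F \<omega> \<subseteq> Rot_sub \<sigma> F \<omega>"
  proof
    fix c assume "c \<in> Rot_ord \<sigma> F \<omega>"
    then obtain x where "?A x \<longlonglongrightarrow> c" by (auto simp: Rot_ord_def)
    then show "c \<in> Rot_sub \<sigma> F \<omega>"
      unfolding Rot_sub_def
      by (intro CollectI exI[of _ "\<lambda>k. k"] exI[of _ "\<lambda>_. x"] conjI filterlim_ident)
  qed
  have I_ord: "?I \<subseteq> Rot_ord \<sigma> F \<omega>" using pt by (auto simp: Rot_ord_def)
  show ?ord ?sub using sub ord_sub I_ord by blast+
  have elu: "(\<lambda>n. ereal (l n)) \<longlonglongrightarrow> ereal (rho 0)" "(\<lambda>n. ereal (u n)) \<longlonglongrightarrow> ereal (rho 1)"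
    using lu by simp_all
  have between: "ereal (rho 0) \<le> liminf (\<lambda>n. ereal (?A x n))" "limsup (\<lambda>n. ereal (?A x n)) \<le> ereal (rho 1)" for x
  proof -
    have "liminf (\<lambda>n. ereal (l n)) \<le> liminf (\<lambda>n. ereal (?A x n))"
      by (intro Liminf_mono always_eventually allI) (simp add: lu)
    then show "ereal (rho 0) \<le> liminf (\<lambda>n. ereal (?A x n))"
      using lim_imp_Liminf[OF _ elu(1)] by simp
    have "limsup (\<lambda>n. ereal (?A x n)) \<le> limsup (\<lambda>n. ereal (u n))"
      by (intro Limsup_mono always_eventually allI) (simp add: lu)
    then show "limsup (\<lambda>n. ereal (?A x n)) \<le> ereal (rho 1)"
      using lim_imp_Limsup[OF _ elu(2)] by simp
  qed
  have le: "liminf (\<lambda>n. ereal (?A x n)) \<le> limsup (\<lambda>n. ereal (?A x n))" for x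
    by (rule Liminf_le_Limsup) simp
  \<comment> \<open>Lying between two finite numbers excludes the infinite values that
    \<open>Rot_plus\<close> and \<open>Rot_minus\<close> admit.\<close>
  have ereal_I: "e \<in> ereal ` ?I" if "ereal (rho 0) \<le> e" "e \<le> ereal (rho 1)" for e
    using that by (cases e) auto
  have lims: "limsup (\<lambda>n. ereal (?A x n)) = ereal c" "liminf (\<lambda>n. ereal (?A x n)) = ereal c"
    if "?A x \<longlonglongrightarrow> c" for x c
    using that by (auto intro!: lim_imp_Limsup lim_imp_Liminf)
  show plus: ?plus
  proof
    have "limsup (\<lambda>n. ereal (?A x n)) \<in> ereal ` ?I" for x
      by (rule ereal_I[OF order_trans[OF between(1) le] between(2)])
    then show "Rot_plus \<sigma> F \<omega> \<subseteq> ereal ` ?I" unfolding Rot_plus_def by blast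
    show "ereal ` ?I \<subseteq> Rot_plus \<sigma> F \<omega>"
    proof (rule image_subsetI)
      fix c assume "c \<in> ?I"
      then obtain x where "?A x \<longlonglongrightarrow> c" using pt by blast
      from lims(1)[OF this, symmetric] show "ereal c \<in> Rot_plus \<sigma> F \<omega>"
        unfolding Rot_plus_def by blast
    qed
  qed
  show ?minus
  proof
    have "liminf (\<lambda>n. ereal (?A x n)) \<in> ereal ` ?I" for x
      by (rule ereal_I[OF between(1) order_trans[OF le between(2)]])
    then show "Rot_minus \<sigma> F \<omega> \<subseteq> ereal ` ?I" unfolding Rot_minus_def by blast
    show "ereal ` ?I \<subseteq> Rot_minus \<sigma> F \<omega>"
    proof (rule image_subsetI)
      fix c assume "c \<in> ?I"
      then obtain x where "?A x \<longlonglongrightarrow> c" using pt by blast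
      from lims(2)[OF this, symmetric] show "ereal c \<in> Rot_minus \<sigma> F \<omega>"
        unfolding Rot_minus_def by blast
    qed
  qed
  \<comment> \<open>The real part of \<open>Rot_plus\<close> is already a closed interval, so the
    closure adds nothing.\<close>
  have "{c. ereal c \<in> Rot_plus \<sigma> F \<omega>} = ?I" unfolding plus by auto
  then show ?rot by (simp add: Rot_def)
qed

end

theorem theorem2p1:
  fixes M :: "'w measure" and \<sigma> :: "'w \<Rightarrow> 'w"
    and f :: "'w \<Rightarrow> circle \<Rightarrow> circle" and F :: "'w \<Rightarrow> real \<Rightarrow> real"
  assumes "ergodic_pmps M \<sigma>"
    and "random_endo_generator M f"
    and "random_lift M f F"
    and "F \<in> integrable_End1 M"
  shows "\<exists>\<Omega>'. \<Omega>' \<in> sets M \<and> \<sigma> -` \<Omega>' \<inter> space M = \<Omega>' \<and> measure M \<Omega>' = 1 \<and>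
    (\<forall>\<omega>\<in>\<Omega>'.
      (ereal ` Rot \<sigma> F \<omega> = Rot_plus \<sigma> F \<omega> \<and>
       Rot_plus \<sigma> F \<omega> = Rot_minus \<sigma> F \<omega> \<and>
       Rot_minus \<sigma> F \<omega> = ereal ` Rot_ord \<sigma> F \<omega> \<and>
       Rot_ord \<sigma> F \<omega> = Rot_sub \<sigma> F \<omega> \<and>
       Rot_sub \<sigma> F \<omega> =
         {mean_rotation_number M \<sigma> (lower_map F)..mean_rotation_number M \<sigma> (upper_map F)}) \<and>
      (\<forall>c\<in>{mean_rotation_number M \<sigma> (lower_map F)..mean_rotation_number M \<sigma> (upper_map F)}.
        \<exists>x\<in>{0..1}. (\<lambda>n. (cocycle \<sigma> F n \<omega> x - x) / real n) \<longlonglongrightarrow> c))"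
proof -
  interpret ergodic_pmps M \<sigma> by fact
  interpret random_endo M \<sigma> F by unfold_locales fact
  show ?thesis
    unfolding rho_zero[symmetric] rho_one[symmetric]
  proof (intro exI[of _ good_set] conjI ballI)
    show "\<exists>x\<in>{0..1}. (\<lambda>n. (cocycle \<sigma> F n \<omega> x - x) / real n) \<longlonglongrightarrow> c"
      if "\<omega> \<in> good_set" "c \<in> {rho 0..rho 1}" for \<omega> c
      using exists_rotation_point[OF that] unfolding avg_displacement_def .
  qed (simp_all only: measurable_good_set good_set_invariant prob_good_set rotation_sets)
qed

end
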